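(* Indices of $p$ and $p'$ are taken modulo $n+1$. For $i=1,\ldots,n+1$ define $\tau_i=p_ip_{i+1}\cdots p_{i+n-1}\sigma$. For $i,j=1,\ldots,n+1$ define \[ \tau_{i,j}=p_ip_{i+1}\cdots p_{i+n-1}\;p'_jp'_{j+1}\cdots p'_n\;\pi_1\;p'_1p'_2\cdots p'_{j-1}, \] where $p'_j\cdots p'_n$ is empty if $j=n+1$ and $p'_1\cdots p'_{j-1}$ is empty if $j=1$. These act on the parameters by \[ \tau_i(a_k)=q^{-\delta_{i,k}}a_k,\quad \tau_i(b_k)=b_k,\quad \tau_i(c)=c, \] \[ \tau_{i,j}(a_k)=q^{\delta_{j,n+1}-\delta_{i,k}}a_k,\quad \tau_{i,j}(b_k)=q^{\delta_{j,n+1}-\delta_{j,k}}b_k,\quad \tau_{i,j}(c)=c. \] Let $M_{\tau_i}$ be the matrix assigned to the word $p_i\cdots p_{i+n-1}\sigma$ by the rule $M_{\omega_2\omega_1}=\omega_2(M_{\omega_1})M_{\omega_2}$; explicitly, \[ M_{\tau_i}=p_i\cdots p_{i+n-1}(M_\sigma)\;p_i\cdots p_{i+n-2}(M_{p_{i+n-1}})\cdots p_i(M_{p_{i+1}})\,M_{p_i}. \] Let $M_{\tau_{i,j}}=\Delta_{i,j}^{-1}N_{i,j}$, where $N_{i,j}$ is the matrix assigned by the same rule to the word defining $\tau_{i,j}$, and \[ \Delta_{i,j}=\frac{1-b_j}{1-a_1}\ (i\ne1,\ j\ne n+1),\qquad \Delta_{1,j}=\frac{1-b_j}{1-q^{-1}a_1}\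 (j\ne n+1), \] \[ \Delta_{i,n+1}=q\,\frac{1-q^{-1}a_i}{1-a_i}\prod_{l=1}^n\frac{1-a_{l+1}}{1-qb_l}\ (i\ne1),\qquad \Delta_{1,n+1}=q\prod_{l=1}^n\frac{1-a_{l+1}}{1-qb_l}. \] Then \[ \mathbf{x}(\tau_i(\mathbf{c}))=M_{\tau_i}\mathbf{x}(\mathbf{c})\ \ (i=1,\ldots,n+1),\qquad \mathbf{x}(\tau_{i,j}(\mathbf{c}))=M_{\tau_{i,j}}\mathbf{x}(\mathbf{c})\ \ (i,j=1,\ldots,n+1). \]
   Context: Fix an integer $n\ge1$ and $q\in\mathbb{C}$ with $0<|q|<1$. Let $a_1,\ldots,a_{n+1},b_1,\ldots,b_n,c$ be generic complex parameters, and write $\mathbf{c}=(a_1,\ldots,a_{n+1},b_1,\ldots,b_n,c)$. Set $b_{n+1}=q$, and extend indices to all of $\mathbb{Z}$ by $a_{j+n+1}=q\,a_j$ and $b_{j+n+1}=q\,b_j$; in particular $a_0=q^{-1}a_{n+1}$ and $b_0=1$. Write $(a;q)_0=1$ and $(a;q)_k=(1-a)(1-qa)\cdots(1-q^{k-1}a)$. For $j=1,\ldots,n+1$ let \[ x_j(\mathbf{c})=\prod_{l=1}^{n-j+1}(1-a_l)\prod_{l=n-j+2}^{n}(1-b_l)\sum_{k=0}^\infty q^kc^k\prod_{l=1}^{n-j+1}\frac{(qa_l;q)_k}{(qb_l;q)_k}\prod_{l=n-j+2}^{n+1}\frac{(a_l;q)_k}{(b_l;q)_k}, \] which converges for $|c|<|q|^{-1}$,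 and set $\mathbf{x}=(x_1,\ldots,x_{n+1})^T$. Let $E_{j_1,j_2}$ denote the $(n+1)\times(n+1)$ matrix unit. For a parameter $u$, $c^{\log_q u}$ means $\exp(\log c\,\log u/\log q)$ for fixed branches. $\delta$ is the Kronecker delta. Substitutions. Each symbol $\omega$ below denotes a substitution $\mathbf{c}\mapsto\omega(\mathbf{c})$, specified by the images of $a_j$ ($1\le j\le n+1$), $b_j$ ($1\le j\le n$) and $c$. Right-hand sides are read using the quasi-periodic convention; the same formulas then hold for all $j$, and $b_{n+1}=q$ stays fixed. For $i\in\mathbb{Z}$ let $t_i$ be the permutation of $\mathbb{Z}$ exchanging $i+k(n+1)$ and $i+1+k(n+1)$ for every $k\in\mathbb{Z}$ and fixing all other integers. - $p_i$ ($0\le i\le n$): $a_j\mapsto a_{t_i(j)}$, $b_j\mapsto b_j$, $c\mapsto c$. - $p'_i$ ($1\le i\le n-1$): $a_j\mapsto a_j$, $b_j\mapsto b_{t_i(j)}$, $c\mapsto c$. - $p'_n$: $a_j\mapsto qa_j/b_n$, $b_j\mapsto qb_{t_n(j)}/b_n$, $c\mapsto c$. - $\sigma$: $a_j\mapsto a_{j-1}$, $b_j\mapsto b_j$, $c\mapsto c$. - $\pi_1$: $a_j\mapsto qa_{j-1}/b_n$, $b_j\mapsto qb_{j-1}/b_n$, $c\mapsto c$. For a function or matrix $\Phi(\mathbf{c})$, $\omega(\Phi)$ denotes $\Phi(\omega(\mathbf{c}))$. Compositions are defined by $(\omega_2\omega_1)(\Phi)=\omega_2(\omega_1(\Phi))$,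 i.e. $\omega_2\omega_1(\mathbf{c})$ is $\omega_1(\mathbf{c})$ with $\mathbf{c}$ replaced by $\omega_2(\mathbf{c})$. Matrices: - $M_{p_0}=\sum_{j=1}^n\frac{a_0-b_0}{a_1-b_0}E_{j,j}+E_{n+1,n+1}+\frac{a_0-a_1}{a_1-b_0}\,qc\,E_{n+1,1}$. - $M_{p_i}=\sum_{j=1}^{n-i}E_{j,j}+\frac{a_{i+1}-b_i}{a_i-b_i}E_{n-i+1,n-i+1}+\sum_{j=n-i+2}^{n+1}E_{j,j}+\frac{a_i-a_{i+1}}{a_i-b_i}E_{n-i+1,n-i+2}$ for $1\le i\le n$. - $M_{p'_i}=\sum_{j=1}^{n-i}E_{j,j}+\frac{b_i-a_{i+1}}{b_{i+1}-a_{i+1}}E_{n-i+1,n-i+1}+\sum_{j=n-i+2}^{n+1}E_{j,j}+\frac{b_{i+1}-b_i}{b_{i+1}-a_{i+1}}E_{n-i+1,n-i}$ for $1\le i\le n-1$. - $M_{p'_n}=c^{\log_q(q^{-1}b_n)}\Bigl(\frac{b_n-a_{n+1}}{b_{n+1}-a_{n+1}}E_{1,1}+\sum_{j=2}^{n+1}E_{j,j}+\frac{b_{n+1}-b_n}{b_{n+1}-a_{n+1}}q^{-1}c^{-1}E_{1,n+1}\Bigr)$. - $M_\sigma=\sum_{j=1}^{n+1}\frac{b_{n-j+1}(a_0-b_0)}{a_{n-j+1}-b_{n-j+1}}E_{j,j}-\sum_{j=1}^{n}\frac{a_{n-j+1}(a_0-b_0)}{a_{n-j+1}-b_{n-j+1}}E_{j,j+1}-a_{n+1}c\,E_{n+1,1}$.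 - $M_{\pi_1}=c^{\log_q(q^{-1}b_n)}\Bigl(\sum_{j=1}^nE_{j,j+1}+qc\,E_{n+1,1}\Bigr)$.
   Formalization: The branches of log are assumed compatible: log(q/b_j)+log(b_j/q)=0 for j=1..n and log(b_n/q)+log(1/b_n)=-log q; with e.g. principal branches the τ_{i,j} identities can fail. "Generic" means c, a_k, b_l nonzero and a_k, b_l, a_k/a_l, b_k/b_l (k≠l), a_k/b_l are not integer powers of q. *)

theory Defs
  imports Complex_Main "Jordan_Normal_Form.Matrix"
begin

text \<open>Parameter vector: (a, b, c).  Only a 1..n+1 and b 1..n are used as data;
  all other indices are obtained by the quasi-periodic convention.\<close>
type_synonym par = "(int \<Rightarrow> complex) \<times> (int \<Rightarrow> complex) \<times> complex"

text \<open>Quasi-periodic extension: f_{j+(n+1)} = q f_j, from the values f_1..f_{n+1}.\<close>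
definition qext :: "nat \<Rightarrow> complex \<Rightarrow> (int \<Rightarrow> complex) \<Rightarrow> int \<Rightarrow> complex" where
  "qext n q f j = q powi ((j - 1) div int (n+1)) * f ((j - 1) mod int (n+1) + 1)"

definition Aof :: "nat \<Rightarrow> complex \<Rightarrow> par \<Rightarrow> int \<Rightarrow> complex" where
  "Aof n q P = qext n q (fst P)"

text \<open>b with b_{n+1} = q, extended quasi-periodically (so b_0 = 1).\<close>
definition Bof :: "nat \<Rightarrow> complex \<Rightarrow> par \<Rightarrow> int \<Rightarrow> complex" where
  "Bof n q P = qext n q ((fst (snd P))(int n + 1 := q))"

definition Cof :: "par \<Rightarrow> complex" where
  "Cof P = snd (snd P)"

definition tperm :: "nat \<Rightarrow> int \<Rightarrow> int \<Rightarrow> int" where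
  "tperm n i j = (if j mod int (n+1) = i mod int (n+1) then j + 1
                  else if j mod int (n+1) = (i + 1) mod int (n+1) then j - 1 else j)"

definition qpoch :: "complex \<Rightarrow> complex \<Rightarrow> nat \<Rightarrow> complex" where
  "qpoch a q k = (\<Prod>i<k. (1 - q ^ i * a))"

text \<open>Letters: P i = p_i (index mod n+1), P' i = p'_i (1 \<le> i \<le> n), Sig = sigma, Pi1 = pi_1.\<close>
datatype letter = P int | P' nat | Sig | Pi1

fun subst :: "nat \<Rightarrow> complex \<Rightarrow> letter \<Rightarrow> par \<Rightarrow> par" where
  "subst n q (P i) X = ((\<lambda>j. Aof n q X (tperm n i j)), fst (snd X), Cof X)"
| "subst n q (P' i) X =
     (if i = n then
        ((\<lambda>j. q * Aof n q X j / Bof n q X (int n)),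
         (\<lambda>j. q * Bof n q X (tperm n (int n) j) / Bof n q X (int n)), Cof X)
      else (fst X, (\<lambda>j. Bof n q X (tperm n (int i) j)), Cof X))"
| "subst n q Sig X = ((\<lambda>j. Aof n q X (j - 1)), fst (snd X), Cof X)"
| "subst n q Pi1 X =
     ((\<lambda>j. q * Aof n q X (j - 1) / Bof n q X (int n)),
      (\<lambda>j. q * Bof n q X (j - 1) / Bof n q X (int n)), Cof X)"

text \<open>Action of a word w1 w2 ... wm: (w2 w1)(c) = w1(c) with c replaced by w2(c).\<close>
fun act :: "nat \<Rightarrow> complex \<Rightarrow> letter list \<Rightarrow> par \<Rightarrow> par" where
  "act n q [] X = X"
| "act n q (w # ws) X = act n q ws (subst n q w X)"

text \<open>c^{log_q u} = exp(log c * log u / log q), for fixed branches lc = log c, lq = log q,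
  lg = a branch of the logarithm.\<close>
definition cpw :: "complex \<Rightarrow> complex \<Rightarrow> (complex \<Rightarrow> complex) \<Rightarrow> complex \<Rightarrow> complex" where
  "cpw lc lq lg u = exp (lc * lg u / lq)"

fun Mlet :: "nat \<Rightarrow> complex \<Rightarrow> complex \<Rightarrow> complex \<Rightarrow> (complex \<Rightarrow> complex) \<Rightarrow> letter \<Rightarrow> par \<Rightarrow> complex mat" where
  "Mlet n q lc lq lg (P i0) X =
    (let a = Aof n q X; b = Bof n q X; c = Cof X; N = int n; i = i0 mod (N + 1) in
     if i = 0 then
       mat (n+1) (n+1) (\<lambda>(r,s). let R = int r + 1; S = int s + 1 in
          (if R = S \<and> 1 \<le> R \<and> R \<le> N then (a 0 - b 0) / (a 1 - b 0) else 0)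
        + (if R = S \<and> R = N + 1 then 1 else 0)
        + (if R = N + 1 \<and> S = 1 then (a 0 - a 1) / (a 1 - b 0) * q * c else 0))
     else
       mat (n+1) (n+1) (\<lambda>(r,s). let R = int r + 1; S = int s + 1 in
          (if R = S \<and> 1 \<le> R \<and> R \<le> N - i then 1 else 0)
        + (if R = S \<and> R = N - i + 1 then (a (i+1) - b i) / (a i - b i) else 0)
        + (if R = S \<and> N - i + 2 \<le> R \<and> R \<le> N + 1 then 1 else 0)
        + (if R = N - i + 1 \<and> S = N - i + 2 then (a i - a (i+1)) / (a i - b i) else 0)))"
| "Mlet n q lc lq lg (P' i0) X =
    (let a = Aof n q X; b = Bof n q X; c = Cof X; N = int n; i = int i0 in
     if i0 = n then
       cpw lc lq lg (inverse q * b N) \<cdot>\<^sub>m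
       mat (n+1) (n+1) (\<lambda>(r,s). let R = int r + 1; S = int s + 1 in
          (if R = S \<and> R = 1 then (b N - a (N+1)) / (b (N+1) - a (N+1)) else 0)
        + (if R = S \<and> 2 \<le> R \<and> R \<le> N + 1 then 1 else 0)
        + (if R = 1 \<and> S = N + 1 then (b (N+1) - b N) / (b (N+1) - a (N+1)) * inverse q * inverse c else 0))
     else
       mat (n+1) (n+1) (\<lambda>(r,s). let R = int r + 1; S = int s + 1 in
          (if R = S \<and> 1 \<le> R \<and> R \<le> N - i then 1 else 0)
        + (if R = S \<and> R = N - i + 1 then (b i - a (i+1)) / (b (i+1) - a (i+1)) else 0)
        + (if R = S \<and> N - i + 2 \<le> R \<and> R \<le> N + 1 then 1 else 0)
        + (if R = N - i + 1 \<and> S = N - i then (b (i+1) - b i) / (b (i+1) - a (i+1)) else 0)))"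
| "Mlet n q lc lq lg Sig X =
    (let a = Aof n q X; b = Bof n q X; c = Cof X; N = int n in
       mat (n+1) (n+1) (\<lambda>(r,s). let R = int r + 1; S = int s + 1 in
          (if R = S \<and> 1 \<le> R \<and> R \<le> N + 1
             then b (N - R + 1) * (a 0 - b 0) / (a (N - R + 1) - b (N - R + 1)) else 0)
        - (if S = R + 1 \<and> 1 \<le> R \<and> R \<le> N
             then a (N - R + 1) * (a 0 - b 0) / (a (N - R + 1) - b (N - R + 1)) else 0)
        - (if R = N + 1 \<and> S = 1 then a (N + 1) * c else 0)))"
| "Mlet n q lc lq lg Pi1 X =
    (let b = Bof n q X; c = Cof X; N = int n in
       cpw lc lq lg (inverse q * b N) \<cdot>\<^sub>m
       mat (n+1) (n+1) (\<lambda>(r,s). let R = int r + 1; S = int s + 1 in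
          (if S = R + 1 \<and> 1 \<le> R \<and> R \<le> N then 1 else 0)
        + (if R = N + 1 \<and> S = 1 then q * c else 0)))"

fun wmat :: "nat \<Rightarrow> complex \<Rightarrow> complex \<Rightarrow> complex \<Rightarrow> (complex \<Rightarrow> complex) \<Rightarrow> letter list \<Rightarrow> par \<Rightarrow> complex mat" where
  "wmat n q lc lq lg [] X = 1\<^sub>m (n+1)"
| "wmat n q lc lq lg (w # ws) X = wmat n q lc lq lg ws (subst n q w X) * Mlet n q lc lq lg w X"

definition xfun :: "nat \<Rightarrow> complex \<Rightarrow> par \<Rightarrow> nat \<Rightarrow> complex" where
  "xfun n q X j = (let a = Aof n q X; b = Bof n q X; c = Cof X in
     (\<Prod>l\<in>{1..n+1-j}. (1 - a (int l))) * (\<Prod>l\<in>{n+2-j..n}. (1 - b (int l))) *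
     (\<Sum>k. q ^ k * c ^ k *
        (\<Prod>l\<in>{1..n+1-j}. qpoch (q * a (int l)) q k / qpoch (q * b (int l)) q k) *
        (\<Prod>l\<in>{n+2-j..n+1}. qpoch (a (int l)) q k / qpoch (b (int l)) q k)))"

definition xvec :: "nat \<Rightarrow> complex \<Rightarrow> par \<Rightarrow> complex vec" where
  "xvec n q X = vec (n+1) (\<lambda>r. xfun n q X (r + 1))"

definition pword :: "nat \<Rightarrow> nat \<Rightarrow> letter list" where
  "pword n i = map (\<lambda>k. P (int i + int k)) [0..<n]"

definition tau_word :: "nat \<Rightarrow> nat \<Rightarrow> letter list" where
  "tau_word n i = pword n i @ [Sig]"

definition tau2_word :: "nat \<Rightarrow> nat \<Rightarrow> nat \<Rightarrow> letter list" where
  "tau2_word n i j = pword n i @ map P' [j..<n+1] @ [Pi1] @ map P' [1..<j]"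

definition Delta :: "nat \<Rightarrow> complex \<Rightarrow> par \<Rightarrow> nat \<Rightarrow> nat \<Rightarrow> complex" where
  "Delta n q X i j = (let a = Aof n q X; b = Bof n q X in
     if j \<noteq> n + 1 then
       (if i \<noteq> 1 then (1 - b (int j)) / (1 - a 1) else (1 - b (int j)) / (1 - inverse q * a 1))
     else
       (if i \<noteq> 1 then q * (1 - inverse q * a (int i)) / (1 - a (int i))
                        * (\<Prod>l\<in>{1..n}. (1 - a (int l + 1)) / (1 - q * b (int l)))
        else q * (\<Prod>l\<in>{1..n}. (1 - a (int l + 1)) / (1 - q * b (int l)))))"

end

theory Submission
  imports Defs
begin

text \<open>Put z = q^k.  All components of x are sums over k of one common weight times the rational
  function prod_{l <= m} (1 - a_l z)/(1 - b_l z) with m = n + 1 - j, so each row of each matrix is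
  an identity between rational functions of z; the rows containing c use in addition the recursion
  of the weight, i.e. a shift of k.  This settles p_i, sigma and p'_i with i < n, for which
  w(x) = M_w x.  The letters p'_n and pi_1 are not separately compatible with x, because they move
  b_{n+1} = q to another slot.  In the words tau_{i,j} they occur as the block p'_n pi_1 (for
  j <= n) or as pi_1 p'_1 ... p'_n (for j = n + 1), and after such a block q is back in its slot,
  the two powers of c cancel up to an explicit power, and x is recovered up to the factor
  Delta_{i,j}.\<close>

definition quasi_periodic :: "nat \<Rightarrow> complex \<Rightarrow> (int \<Rightarrow> complex) \<Rightarrow> bool" where
  "quasi_periodic n q g \<longleftrightarrow> (\<forall>j. g (j + int (n + 1)) = q * g j)"

definition shift_equivariant :: "nat \<Rightarrow> (int \<Rightarrow> int) \<Rightarrow> bool" where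
  "shift_equivariant n t \<longleftrightarrow> (\<forall>j. t (j + int (n + 1)) = t j + int (n + 1))"

definition generic :: "nat \<Rightarrow> complex \<Rightarrow> (int \<Rightarrow> complex) \<Rightarrow> (int \<Rightarrow> complex) \<Rightarrow> complex \<Rightarrow> bool" where
  "generic n q A B c \<longleftrightarrow> quasi_periodic n q A \<and> quasi_periodic n q B \<and> B 0 = 1 \<and> inj B \<and> (\<forall>k l. A k \<noteq> B l) \<and>
     c \<noteq> 0 \<and> norm (q * c) < 1"

definition lin_prod :: "(int \<Rightarrow> complex) \<Rightarrow> nat \<Rightarrow> complex \<Rightarrow> complex" where
  "lin_prod A m z = (\<Prod>l\<in>{1..m}. 1 - z * A (int l))"

definition qpoch_prod :: "complex \<Rightarrow> (int \<Rightarrow> complex) \<Rightarrow> nat \<Rightarrow> nat \<Rightarrow> complex" where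
  "qpoch_prod q A m k = (\<Prod>l\<in>{1..m}. qpoch (A (int l)) q k)"

definition weight :: "nat \<Rightarrow> complex \<Rightarrow> (int \<Rightarrow> complex) \<Rightarrow> (int \<Rightarrow> complex) \<Rightarrow> complex \<Rightarrow> nat \<Rightarrow> complex" where
  "weight n q A B c k = (q * c) ^ k * (qpoch_prod q A (n + 1) k / qpoch_prod q B (n + 1) k)"

definition weighted_sum :: "nat \<Rightarrow> complex \<Rightarrow> (int \<Rightarrow> complex) \<Rightarrow> (int \<Rightarrow> complex) \<Rightarrow> complex
    \<Rightarrow> (complex \<Rightarrow> complex) \<Rightarrow> complex" where
  "weighted_sum n q A B c g = (\<Sum>k. weight n q A B c k * g (q ^ k))"

text \<open>The component x_{n+1-m}: the index m counts the numerator factors.\<close>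

definition xcomp :: "nat \<Rightarrow> complex \<Rightarrow> (int \<Rightarrow> complex) \<Rightarrow> (int \<Rightarrow> complex) \<Rightarrow> complex \<Rightarrow> nat \<Rightarrow> complex" where
  "xcomp n q A B c m = lin_prod B n 1 * weighted_sum n q A B c (\<lambda>z. lin_prod A m z / lin_prod B m z)"

lemma lin_prod_0 [simp]: "lin_prod A 0 z = 1"
  by (simp add: lin_prod_def)

lemma lin_prod_Suc: "lin_prod A (Suc m) z = lin_prod A m z * (1 - z * A (int m + 1))"
  by (simp add: lin_prod_def add.commute)

lemma lin_prod_at_0 [simp]: "lin_prod A m 0 = 1"
  by (simp add: lin_prod_def)

lemma lin_prod_pos: "m \<ge> 1 \<Longrightarrow> lin_prod A m z = lin_prod A (m - 1) z * (1 - z * A (int m))"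
  using lin_prod_Suc[of A "m - 1" z] by (simp add: of_nat_diff)

lemma lin_prod_shift: "m \<ge> 1 \<Longrightarrow> lin_prod (\<lambda>j. A (j - 1)) m z = (1 - z * A 0) * lin_prod A (m - 1) z"
proof (induction m rule: dec_induct)
  case base
  then show ?case by (simp add: lin_prod_def)
next
  case (step m)
  then show ?case by (simp add: lin_prod_Suc lin_prod_pos)
qed

lemma lin_prod_scale: "lin_prod (\<lambda>j. s * A j) m z = lin_prod A m (s * z)"
  by (simp add: lin_prod_def mult_ac)

lemma tendsto_lin_prod: "(f \<longlongrightarrow> z) F \<Longrightarrow> ((\<lambda>k. lin_prod A m (f k)) \<longlongrightarrow> lin_prod A m z) F"
  unfolding lin_prod_def by (intro tendsto_intros)

lemma qpoch_prod_Suc: "qpoch_prod q A (Suc m) k = qpoch_prod q A m k * qpoch (A (int m + 1)) q k"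
  by (simp add: qpoch_prod_def add.commute)

lemma qpoch_0 [simp]: "qpoch a q 0 = 1"
  by (simp add: qpoch_def)

lemma qpoch_Suc: "qpoch a q (Suc k) = qpoch a q k * (1 - q ^ k * a)"
  by (simp add: qpoch_def)

lemma qpoch_shift: "(1 - a) * qpoch (q * a) q k = qpoch a q k * (1 - q ^ k * a)"
proof (induction k)
  case (Suc k)
  have "(1 - a) * qpoch (q * a) q (Suc k) = ((1 - a) * qpoch (q * a) q k) * (1 - q ^ Suc k * a)"
    by (simp add: qpoch_Suc mult_ac)
  then show ?case unfolding Suc.IH by (simp add: qpoch_Suc)
qed simp

lemma qpoch_prod_Suc_right: "qpoch_prod q A m (Suc k) = qpoch_prod q A m k * lin_prod A m (q ^ k)"
  by (simp add: qpoch_prod_def qpoch_Suc lin_prod_def prod.distrib)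

lemma qpoch_prod_shift: "m \<ge> 1 \<Longrightarrow> qpoch_prod q (\<lambda>j. A (j - 1)) m k = qpoch (A 0) q k * qpoch_prod q A (m - 1) k"
proof (induction m rule: dec_induct)
  case base
  then show ?case by (simp add: qpoch_prod_def)
next
  case (step m)
  then show ?case using qpoch_prod_Suc[of q A "m - 1" k] by (simp add: qpoch_prod_Suc of_nat_diff)
qed

lemma qpoch_prod_scale: "lin_prod A m 1 * qpoch_prod q (\<lambda>j. q * A j) m k = qpoch_prod q A m k * lin_prod A m (q ^ k)"
  by (simp add: qpoch_prod_def lin_prod_def flip: prod.distrib) (simp add: qpoch_shift)

lemma lin_prod_cong: "(\<And>l. 1 \<le> l \<Longrightarrow> l \<le> int m \<Longrightarrow> A l = A' l) \<Longrightarrow> lin_prod A m z = lin_prod A' m z"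
  by (simp add: lin_prod_def)

lemma qpoch_prod_cong: "(\<And>l. 1 \<le> l \<Longrightarrow> l \<le> int m \<Longrightarrow> A l = A' l) \<Longrightarrow> qpoch_prod q A m k = qpoch_prod q A' m k"
  by (simp add: qpoch_prod_def)

subsection \<open>Index permutations\<close>

lemma mod_eq_shift_iff:
  fixes i j N :: int
  assumes "0 \<le> r" "r < N"
  shows "j mod N = (i + r) mod N \<longleftrightarrow> (j - i) mod N = r"
proof -
  have "j mod N = (i + r) mod N \<longleftrightarrow> N dvd (j - i - r)"
    by (simp add: mod_eq_dvd_iff algebra_simps)
  also have "\<dots> \<longleftrightarrow> (j - i) mod N = r mod N"
    by (simp add: mod_eq_dvd_iff)
  finally show ?thesis using assms by simp
qed

lemma tperm_shift_equivariant: "shift_equivariant n (tperm n i)"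
  by (simp add: shift_equivariant_def tperm_def)

lemma tperm_inv:
  assumes "n \<ge> 1"
  shows "tperm n i (tperm n i j) = j"
proof -
  have *: "(j + 1) mod int (n+1) = (i + 1) mod int (n+1) \<longleftrightarrow> j mod int (n+1) = i mod int (n+1)"
      "(j - 1) mod int (n+1) = i mod int (n+1) \<longleftrightarrow> j mod int (n+1) = (i + 1) mod int (n+1)" for j
    by (auto simp: mod_eq_dvd_iff algebra_simps)
  have "(i + 1) mod int (n+1) \<noteq> i mod int (n+1)"
    using assms by (auto simp: mod_eq_dvd_iff zdvd_not_zless)
  then show ?thesis using *[of j] unfolding tperm_def by auto
qed

lemma tperm_inj: "n \<ge> 1 \<Longrightarrow> inj (tperm n i)"
  by (metis injI tperm_inv)

lemma tperm_in:
  assumes "0 \<le> i" "i \<le> int n" "0 \<le> j" "j \<le> int n + 1" "n \<ge> 1"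
  shows "tperm n i j = (if j = i then i + 1 else if j = i + 1 then i
     else if i = 0 \<and> j = int n + 1 then int n + 2
     else if i = int n \<and> j = 0 then - 1 else j)"
proof -
  have "i mod (int n + 1) = i" using assms by simp
  moreover have "(i + 1) mod (int n + 1) = (if i = int n then 0 else i + 1)"
    using assms by auto
  moreover have "j mod (int n + 1) = (if j = int n + 1 then 0 else j)"
    using assms by auto
  ultimately show ?thesis using assms unfolding tperm_def by (auto simp: add.commute split: if_splits)
qed

text \<open>Closed form of the composition t_i t_{i+1} ... t_{i+r-1}, for r <= n.\<close>

definition cyc :: "nat \<Rightarrow> int \<Rightarrow> nat \<Rightarrow> int \<Rightarrow> int" where
  "cyc n i r j = (let s = (j - i) mod int (n + 1) in
     if s < int r then j + 1 else if s = int r then j - int r else j)"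

lemma cyc_0 [simp]: "cyc n i 0 j = j"
  by (simp add: cyc_def Let_def not_less)

lemma cyc_Suc:
  assumes "r < n"
  shows "cyc n i r (tperm n (i + int r) j) = cyc n i (Suc r) j"
proof -
  define N where "N = int (n + 1)"
  define s where "s = (j - i) mod N"
  have N: "int r + 1 < N" using assms by (simp add: N_def)
  have t: "tperm n (i + int r) j = (if s = int r then j + 1 else if s = int r + 1 then j - 1 else j)"
    unfolding tperm_def s_def N_def[symmetric]
    using N mod_eq_shift_iff[of "int r" N j i] mod_eq_shift_iff[of "int r + 1" N j i]
    by (simp add: add.assoc)
  have a: "(j + 1 - i) mod N = int r + 1" if "s = int r"
  proof -
    have "(j + 1 - i) mod N = (s + 1) mod N" unfolding s_def by (simp add: mod_simps algebra_simps)
    then show ?thesis using that N by simp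
  qed
  have b: "(j - 1 - i) mod N = int r" if "s = int r + 1"
  proof -
    have "(j - 1 - i) mod N = (s - 1) mod N" unfolding s_def by (simp add: mod_simps algebra_simps)
    then show ?thesis using that N by simp
  qed
  have cyc: "cyc n i r j = (let s = (j - i) mod N in
     if s < int r then j + 1 else if s = int r then j - int r else j)" for r j
    unfolding cyc_def N_def ..
  show ?thesis
    unfolding t cyc Let_def s_def[symmetric] using a b s_def by auto
qed

lemma prod_tperm:
  fixes G :: "int \<Rightarrow> 'a :: comm_monoid_mult"
  assumes "1 \<le> i" "i \<le> n" "m \<le> n + 1"
  shows "(\<Prod>l\<in>{1..m}. G (tperm n (int i) (int l))) =
    (if m = i then (\<Prod>l\<in>{1..i - 1}. G (int l)) * G (int i + 1) else (\<Prod>l\<in>{1..m}. G (int l)))"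
proof -
  have t: "tperm n (int i) (int l) = (if l = i then int i + 1 else if l = i + 1 then int i else int l)"
    if "1 \<le> l" "l \<le> n + 1" for l
    using tperm_in[of "int i" n "int l"] that assms by auto
  obtain i' where i': "i = Suc i'" using assms by (cases i) auto
  have lt: "(\<Prod>l\<in>{1..m}. G (tperm n (int i) (int l))) = (\<Prod>l\<in>{1..m}. G (int l))" if "m < i" for m
    using that assms t by (intro prod.cong) auto
  consider "m < i" | "m = i" | "m \<ge> i + 1" by linarith
  then show ?thesis
  proof cases
    case 2
    then show ?thesis using lt[of i'] t[of i] assms i' by (simp add: add.commute)
  next
    case 3
    then have "m \<le> n + 1 \<longrightarrow> (\<Prod>l\<in>{1..m}. G (tperm n (int i) (int l))) = (\<Prod>l\<in>{1..m}. G (int l))"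
    proof (induction m rule: dec_induct)
      case base
      then show ?case using lt[of i'] t[of i] t[of "i+1"] assms i'
        by (auto simp: algebra_simps)
    next
      case (step m)
      then show ?case using t[of "Suc m"] by auto
    qed
    then show ?thesis using 3 assms by simp
  qed (use lt in auto)
qed

lemma lin_prod_tperm:
  assumes "1 \<le> i" "i \<le> n" "m \<le> n + 1"
  shows "lin_prod (\<lambda>j. A (tperm n (int i) j)) m z =
    (if m = i then lin_prod A (i - 1) z * (1 - z * A (int i + 1)) else lin_prod A m z)"
  unfolding lin_prod_def using prod_tperm[OF assms, of "\<lambda>l. 1 - z * A l"] .

lemma qpoch_prod_tperm:
  assumes "1 \<le> i" "i \<le> n"
  shows "qpoch_prod q (\<lambda>j. A (tperm n (int i) j)) (n + 1) k = qpoch_prod q A (n + 1) k"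
  unfolding qpoch_prod_def using prod_tperm[OF assms, of "n + 1" "\<lambda>l. qpoch (A l) q k"] assms by auto

lemma quasi_periodic_add_mult: "quasi_periodic n q g \<Longrightarrow> g (j + int k * int (n + 1)) = q ^ k * g j"
proof (induction k)
  case (Suc k)
  have "g (j + int (Suc k) * int (n + 1)) = g (j + int k * int (n + 1) + int (n + 1))"
    by (simp add: algebra_simps)
  also have "\<dots> = q * (q ^ k * g j)" using Suc unfolding quasi_periodic_def by metis
  finally show ?case by simp
qed simp

lemma frac_swap_a:
  fixes z a a' b p r :: "'a :: field"
  assumes "a \<noteq> b" "1 - z * b \<noteq> 0" "r \<noteq> 0"
  shows "p * (1 - z * a') / (r * (1 - z * b)) =
    (a' - b) / (a - b) * (p * (1 - z * a) / (r * (1 - z * b))) + (a - a') / (a - b) * (p / r)"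
proof -
  have "(1 - z * a') = (a' - b) / (a - b) * (1 - z * a) + (a - a') / (a - b) * (1 - z * b)"
    using assms(1) by (simp add: divide_simps) (simp add: algebra_simps)
  then have "p * (1 - z * a') / (r * (1 - z * b)) = p * ((a' - b) / (a - b) * (1 - z * a) +
    (a - a') / (a - b) * (1 - z * b)) / (r * (1 - z * b))" by simp
  also have "\<dots> = (a' - b) / (a - b) * (p * (1 - z * a) / (r * (1 - z * b))) +
      (a - a') / (a - b) * (p * (1 - z * b) / (r * (1 - z * b)))"
    by (simp add: add_divide_distrib distrib_left mult_ac)
  finally show ?thesis using assms by simp
qed

lemma frac_swap_b:
  fixes z a b b' p r :: "'a :: field"
  assumes "a \<noteq> b'" "1 - z * b \<noteq> 0" "1 - z * b' \<noteq> 0" "r \<noteq> 0"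
  shows "p / (r * (1 - z * b')) =
    (b - a) / (b' - a) * (p / (r * (1 - z * b))) +
    (b' - b) / (b' - a) * (p * (1 - z * a) / (r * (1 - z * b) * (1 - z * b')))"
proof -
  have "1 - z * b = (b - a) / (b' - a) * (1 - z * b') + (b' - b) / (b' - a) * (1 - z * a)"
    using assms(1) by (simp add: divide_simps) (simp add: algebra_simps)
  then have "p * (1 - z * b) / (r * (1 - z * b) * (1 - z * b')) = p * ((b - a) / (b' - a) * (1 - z * b') +
    (b' - b) / (b' - a) * (1 - z * a)) / (r * (1 - z * b) * (1 - z * b'))" by simp
  also have "\<dots> = (b - a) / (b' - a) * (p * (1 - z * b') / (r * (1 - z * b) * (1 - z * b'))) +
      (b' - b) / (b' - a) * (p * (1 - z * a) / (r * (1 - z * b) * (1 - z * b')))"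
    by (simp add: add_divide_distrib distrib_left mult_ac)
  finally show ?thesis using assms by simp
qed

subsection \<open>Generic parameters and convergence\<close>

locale qhyp =
  fixes n :: nat and q :: complex
  assumes n1: "n \<ge> 1" and q0: "q \<noteq> 0" and q1: "norm q < 1"
begin

lemma genericD:
  assumes "generic n q A B c"
  shows "A (int n + 1) = q * A 0" "B (int n + 1) = q" "A (int n) = q * A (- 1)" "B (int n) = q * B (- 1)"
    "B 0 = 1" "c \<noteq> 0" "norm (q * c) < 1" "A k \<noteq> B l" "B l \<noteq> 0" "k \<noteq> l \<Longrightarrow> B k \<noteq> B l"
proof -
  have *: "quasi_periodic n q A" "quasi_periodic n q B" "B 0 = 1" "inj B" "A k \<noteq> B l" "c \<noteq> 0" "norm (q * c) < 1"
    using assms unfolding generic_def by auto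
  show "A (int n + 1) = q * A 0" "B (int n + 1) = q" "A (int n) = q * A (- 1)" "B (int n) = q * B (- 1)"
    using *(1-3) unfolding quasi_periodic_def
    by (metis add_0 of_nat_1 of_nat_add mult.right_neutral, metis add_0 of_nat_1 of_nat_add mult.right_neutral,
        metis add.commute add_diff_cancel_left' diff_conv_add_uminus of_nat_1 of_nat_add add.assoc,
        metis add.commute add_diff_cancel_left' diff_conv_add_uminus of_nat_1 of_nat_add add.assoc)
  have "B (l + int (n + 1)) \<noteq> B l" using *(4) by (auto dest: injD)
  then show "B l \<noteq> 0" using *(2) unfolding quasi_periodic_def by auto
  show "B k \<noteq> B l" if "k \<noteq> l" using that *(4) by (auto dest: injD)
qed (use assms in \<open>auto simp: generic_def\<close>)

lemma generic_nonzero: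
  assumes "generic n q A B c"
  shows "1 - q ^ k * A l \<noteq> 0" and "l \<ge> 1 \<Longrightarrow> 1 - q ^ k * B l \<noteq> 0"
proof -
  have *: "quasi_periodic n q A" "quasi_periodic n q B" "B 0 = 1" "inj B" "\<And>k l. A k \<noteq> B l"
    using assms unfolding generic_def by auto
  show "1 - q ^ k * A l \<noteq> 0"
    using quasi_periodic_add_mult[OF *(1), of l k] *(3) *(5)[of "l + int k * int (n + 1)" 0] by auto
  assume "l \<ge> 1"
  then have "l + int k * int (n + 1) \<noteq> 0" by (smt (verit) mult_nonneg_nonneg of_nat_0_le_iff)
  then have "B (l + int k * int (n + 1)) \<noteq> B 0" using *(4) by (auto dest: injD)
  then show "1 - q ^ k * B l \<noteq> 0"
    using quasi_periodic_add_mult[OF *(2), of l k] *(3) by auto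
qed

lemma lin_prod_B_nonzero: "generic n q A B c \<Longrightarrow> lin_prod B m (q ^ k) \<noteq> 0"
  unfolding lin_prod_def using generic_nonzero(2) by simp

lemma lin_prod_B_nonzero': "generic n q A B c \<Longrightarrow> lin_prod B m 1 \<noteq> 0"
  using lin_prod_B_nonzero[of A B c m 0] by simp

lemma lin_prod_A_nonzero: "generic n q A B c \<Longrightarrow> lin_prod A m (q ^ k) \<noteq> 0"
  unfolding lin_prod_def using generic_nonzero(1) by simp

lemma power_q_tendsto: "(\<lambda>k. q ^ k) \<longlonglongrightarrow> 0"
  using LIMSEQ_power_zero[OF q1] .

lemma weight_Suc:
  assumes "generic n q A B c"
  shows "weight n q A B c (Suc k) = q * c * (lin_prod A (n + 1) (q ^ k) / lin_prod B (n + 1) (q ^ k)) * weight n q A B c k"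
  by (simp add: weight_def qpoch_prod_Suc_right mult_ac)

lemma summable_weight:
  assumes g: "generic n q A B c" and h: "(\<lambda>k. h (q ^ k)) \<longlonglongrightarrow> L"
  shows "summable (\<lambda>k. weight n q A B c k * h (q ^ k))"
proof -
  have "(\<lambda>k. q * c * (lin_prod A (n + 1) (q ^ k) / lin_prod B (n + 1) (q ^ k))) \<longlonglongrightarrow> q * c * (lin_prod A (n + 1) 0 / lin_prod B (n + 1) 0)"
    by (intro tendsto_intros tendsto_lin_prod power_q_tendsto) simp
  then have lim: "(\<lambda>k. norm (q * c * (lin_prod A (n + 1) (q ^ k) / lin_prod B (n + 1) (q ^ k)))) \<longlonglongrightarrow> norm (q * c)"
    using tendsto_norm by fastforce
  obtain r where r: "norm (q * c) < r" "r < 1" using genericD(7)[OF g] dense by blast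
  then obtain N where N: "\<And>k. k \<ge> N \<Longrightarrow> norm (q * c * (lin_prod A (n + 1) (q ^ k) / lin_prod B (n + 1) (q ^ k))) < r"
    using order_tendstoD(2)[OF lim r(1)] unfolding eventually_sequentially by blast
  have "summable (\<lambda>k. norm (weight n q A B c k))"
  proof (rule summable_ratio_test[OF r(2), of N])
    fix k assume "k \<ge> N"
    from less_imp_le[OF N[OF this]]
    show "norm (norm (weight n q A B c (Suc k))) \<le> r * norm (norm (weight n q A B c k))"
      unfolding weight_Suc[OF g] norm_mult[of _ "weight n q A B c k"] by (simp add: mult_right_mono)
  qed
  moreover have "Bseq (\<lambda>k. h (q ^ k))" using h convergentI convergent_imp_Bseq by blast
  then obtain K where K: "\<And>k. norm (h (q ^ k)) \<le> K" unfolding Bseq_def by blast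
  ultimately have "summable (\<lambda>k. norm (weight n q A B c k) * K)" by (intro summable_mult2)
  then show ?thesis
    by (rule summable_comparison_test'[of _ 0]) (simp add: norm_mult mult_left_mono K)
qed

definition converges_along :: "(complex \<Rightarrow> complex) \<Rightarrow> bool" where
  "converges_along h \<longleftrightarrow> convergent (\<lambda>k. h (q ^ k))"

lemma converges_along_simple: "converges_along (\<lambda>z. z)" "converges_along (\<lambda>z. s)"
  using power_q_tendsto by (auto simp: converges_along_def convergent_const intro: convergentI)

lemma converges_along_mult: "converges_along f \<Longrightarrow> converges_along g \<Longrightarrow> converges_along (\<lambda>z. f z * g z)"
  unfolding converges_along_def by (rule convergent_mult)

lemma converges_along_quotient: "converges_along (\<lambda>z. lin_prod A m z / lin_prod B m' z)"
  unfolding converges_along_def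
  by (rule convergentI, rule tendsto_divide[OF tendsto_lin_prod[OF power_q_tendsto] tendsto_lin_prod[OF power_q_tendsto]]) simp

lemma converges_along_frac: "converges_along (\<lambda>z. (1 - z * s) / (1 - z * s'))" "converges_along (\<lambda>z. (1 - z) / (1 - z * s'))"
proof -
  show *: "converges_along (\<lambda>z. (1 - z * s) / (1 - z * s'))" for s s'
    unfolding converges_along_def
    by (rule convergentI, rule tendsto_divide[where a = "1 - 0 * s" and b = "1 - 0 * s'"];
        (intro tendsto_intros power_q_tendsto)?; simp)
  show "converges_along (\<lambda>z. (1 - z) / (1 - z * s'))" using *[of 1] by simp
qed

lemmas converges_along_intros = converges_along_simple converges_along_mult converges_along_quotient converges_along_frac

lemma summable_weight_mult: "generic n q A B c \<Longrightarrow> converges_along h \<Longrightarrow> summable (\<lambda>k. weight n q A B c k * h (q ^ k))"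
  using summable_weight unfolding converges_along_def convergent_def by blast

lemma weighted_sum_lin:
  assumes "generic n q A B c" "converges_along f" "converges_along g"
  shows "weighted_sum n q A B c (\<lambda>z. s * f z + t * g z) = s * weighted_sum n q A B c f + t * weighted_sum n q A B c g"
  unfolding weighted_sum_def using summable_weight_mult[OF assms(1,2)] summable_weight_mult[OF assms(1,3)]
  by (simp add: suminf_mult[symmetric] suminf_add summable_mult algebra_simps)

lemma weighted_sum_scale:
  assumes "generic n q A B c" "converges_along f"
  shows "weighted_sum n q A B c (\<lambda>z. s * f z) = s * weighted_sum n q A B c f"
  using weighted_sum_lin[OF assms(1,2,2), of s 0] by simp

lemma weighted_sum_cong:
  assumes "\<And>k. weight n q A B c k * f (q ^ k) = weight n q A' B' c' k * g (q ^ k)"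
  shows "weighted_sum n q A B c f = weighted_sum n q A' B' c' g"
  using assms by (simp add: weighted_sum_def)

lemma weighted_sum_step:
  assumes g: "generic n q A B c" and f: "converges_along f"
  shows "weighted_sum n q A B c (\<lambda>z. (1 - z) / (1 - z * A 0) * f z) =
    (\<Sum>k. q * c * weight n q A B c k * (lin_prod A n (q ^ k) / lin_prod B n (q ^ k)) * f (q ^ Suc k))"
proof -
  let ?u = "\<lambda>k. weight n q A B c k * ((1 - q ^ k) / (1 - q ^ k * A 0) * f (q ^ k))"
  have "converges_along (\<lambda>z. (1 - z) / (1 - z * A 0) * f z)" by (intro converges_along_intros f)
  then have "summable ?u" using summable_weight_mult[OF g] by fast
  then have "weighted_sum n q A B c (\<lambda>z. (1 - z) / (1 - z * A 0) * f z) = (\<Sum>k. ?u (Suc k))"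
    unfolding weighted_sum_def by (subst suminf_split_head) simp_all
  also have "\<dots> = (\<Sum>k. q * c * weight n q A B c k * (lin_prod A n (q ^ k) / lin_prod B n (q ^ k)) * f (q ^ Suc k))"
  proof (rule suminf_cong)
    fix k
    have "1 - q ^ k * q \<noteq> 0" using generic_nonzero(2)[OF g, of "int n + 1" k] genericD(2)[OF g] by simp
    moreover have "1 - q ^ k * (q * A 0) \<noteq> 0" using generic_nonzero(1)[OF g, of k "int n + 1"] genericD(1)[OF g] by simp
    ultimately show "?u (Suc k) = q * c * weight n q A B c k * (lin_prod A n (q ^ k) / lin_prod B n (q ^ k)) * f (q ^ Suc k)"
      using lin_prod_B_nonzero[OF g, of n k]
      unfolding weight_Suc[OF g] by (simp add: lin_prod_Suc genericD[OF g] mult_ac)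
  qed
  finally show ?thesis .
qed

text \<open>Shift of the summation index: no term at k = 0 is lost because b_0 = 1.\<close>
lemma weighted_sum_shift:
  assumes g: "generic n q A B c"
  shows "q * c * weighted_sum n q A B c (\<lambda>z. lin_prod A n z / lin_prod B n z) = weighted_sum n q A B c (\<lambda>z. (1 - z) / (1 - z * A 0))"
proof -
  have "summable (\<lambda>k. weight n q A B c k * (lin_prod A n (q ^ k) / lin_prod B n (q ^ k)))"
    using summable_weight_mult[OF g converges_along_quotient] .
  from suminf_mult[OF this, of "q * c"] show ?thesis
    using weighted_sum_step[OF g converges_along_simple(2)[of 1]] by (simp add: weighted_sum_def mult_ac)
qed

lemma xcomp_lin:
  assumes "generic n q A B c"
  shows "s * xcomp n q A B c m + t * xcomp n q A B c m' =
    lin_prod B n 1 * weighted_sum n q A B c (\<lambda>z. s * (lin_prod A m z / lin_prod B m z) + t * (lin_prod A m' z / lin_prod B m' z))"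
  unfolding weighted_sum_lin[OF assms converges_along_quotient converges_along_quotient] xcomp_def by (simp add: algebra_simps)

lemma xcomp_top:
  assumes "generic n q A B c"
  shows "q * c * xcomp n q A B c n = lin_prod B n 1 * weighted_sum n q A B c (\<lambda>z. (1 - z) / (1 - z * A 0))"
  unfolding weighted_sum_shift[OF assms, symmetric] xcomp_def by (simp add: mult_ac)

lemma xcomp_0: "xcomp n q A B c 0 = lin_prod B n 1 * weighted_sum n q A B c (\<lambda>z. 1)"
  by (simp add: xcomp_def)

lemma xcomp_tperm_a:
  assumes g: "generic n q A B c" and i: "1 \<le> i" "i \<le> n" and m: "m \<le> n"
  shows "xcomp n q (\<lambda>j. A (tperm n (int i) j)) B c m =
    (if m = i then (A (int i + 1) - B (int i)) / (A (int i) - B (int i)) * xcomp n q A B c i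
       + (A (int i) - A (int i + 1)) / (A (int i) - B (int i)) * xcomp n q A B c (i - 1)
     else xcomp n q A B c m)"
proof (cases "m = i")
  case True
  have weight: "weight n q (\<lambda>j. A (tperm n (int i) j)) B c k = weight n q A B c k" for k
    unfolding weight_def using qpoch_prod_tperm[OF i, of q A k] by simp
  let ?D = "A (int i) - B (int i)"
  have D: "?D \<noteq> 0" using genericD(8)[OF g] by simp
  have "lin_prod A (i - 1) (q ^ k) * (1 - q ^ k * A (int i + 1)) / lin_prod B i (q ^ k) =
     (A (int i + 1) - B (int i)) / ?D * (lin_prod A i (q ^ k) / lin_prod B i (q ^ k))
       + (A (int i) - A (int i + 1)) / ?D * (lin_prod A (i - 1) (q ^ k) / lin_prod B (i - 1) (q ^ k))" for k
    using frac_swap_a[of "A (int i)" "B (int i)" "q ^ k" "lin_prod B (i - 1) (q ^ k)"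
        "lin_prod A (i - 1) (q ^ k)" "A (int i + 1)"] D generic_nonzero(2)[OF g, of "int i" k]
        lin_prod_B_nonzero[OF g, of "i - 1" k] i unfolding lin_prod_pos[OF i(1)] by simp
  then show ?thesis
    unfolding True xcomp_lin[OF g] using i
    by (simp add: xcomp_def lin_prod_tperm weighted_sum_def weight)
next
  case False
  have weight: "weight n q (\<lambda>j. A (tperm n (int i) j)) B c k = weight n q A B c k" for k
    unfolding weight_def using qpoch_prod_tperm[OF i, of q A k] by simp
  show ?thesis using False i m by (simp add: xcomp_def lin_prod_tperm weighted_sum_def weight)
qed

lemma xcomp_tperm_b:
  assumes g: "generic n q A B c" and i: "1 \<le> i" "i < n" and m: "m \<le> n"
  shows "xcomp n q A (\<lambda>j. B (tperm n (int i) j)) c m =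
    (if m = i then (B (int i) - A (int i + 1)) / (B (int i + 1) - A (int i + 1)) * xcomp n q A B c i
       + (B (int i + 1) - B (int i)) / (B (int i + 1) - A (int i + 1)) * xcomp n q A B c (i + 1)
     else xcomp n q A B c m)"
proof -
  have i': "i \<le> n" using i by simp
  have weight: "weight n q A (\<lambda>j. B (tperm n (int i) j)) c k = weight n q A B c k" for k
    unfolding weight_def using qpoch_prod_tperm[OF i(1) i', of q B k] by simp
  show ?thesis
  proof (cases "m = i")
    case True
    let ?D = "B (int i + 1) - A (int i + 1)"
    have D: "?D \<noteq> 0" using genericD(8)[OF g] by (metis right_minus_eq)
    have "lin_prod A i (q ^ k) / (lin_prod B (i - 1) (q ^ k) * (1 - q ^ k * B (int i + 1))) =
       (B (int i) - A (int i + 1)) / ?D * (lin_prod A i (q ^ k) / lin_prod B i (q ^ k))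
         + (B (int i + 1) - B (int i)) / ?D * (lin_prod A (i + 1) (q ^ k) / lin_prod B (i + 1) (q ^ k))" for k
      using frac_swap_b[of "A (int i + 1)" "B (int i + 1)" "q ^ k" "B (int i)" "lin_prod B (i - 1) (q ^ k)"
        "lin_prod A i (q ^ k)"] D generic_nonzero(2)[OF g, of "int i" k] generic_nonzero(2)[OF g, of "int i + 1" k]
        lin_prod_B_nonzero[OF g, of "i - 1" k] i unfolding lin_prod_Suc Suc_eq_plus1[symmetric] lin_prod_pos[OF i(1), of B]
      by simp
    then show ?thesis
      unfolding True if_P[OF refl] xcomp_lin[OF g] using i
      by (simp add: xcomp_def lin_prod_tperm weighted_sum_def weight)
  next
    case False
    show ?thesis using False i m by (simp add: xcomp_def lin_prod_tperm weighted_sum_def weight)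
  qed
qed

end

subsection \<open>Transformation of the components\<close>

lemma frac_swap_0:
  fixes z a a' :: "'a :: field"
  assumes "1 - a' \<noteq> 0" "1 - z * a \<noteq> 0"
  shows "(1 - a) / (1 - a') * ((1 - z * a') / (1 - z * a)) =
    1 + (a - a') / (a' - 1) * ((1 - z) / (1 - z * a))"
proof -
  have "a' - 1 \<noteq> 0" using assms by auto
  then show ?thesis using assms by (simp add: divide_simps) (simp add: algebra_simps)
qed

lemma frac_sigma:
  fixes z a b p r :: "'a :: field"
  assumes "a \<noteq> b" "1 - z * b \<noteq> 0" "r \<noteq> 0"
  shows "(1 - a0) * (p / (r * (1 - z * b))) =
    b * (a0 - 1) / (a - b) * (p * (1 - z * a) / (r * (1 - z * b))) - a * (a0 - 1) / (a - b) * (p / r)"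
proof -
  have "1 - a0 = b * (a0 - 1) / (a - b) * (1 - z * a) - a * (a0 - 1) / (a - b) * (1 - z * b)"
    using assms(1) by (simp add: divide_simps) (simp add: algebra_simps)
  moreover define K where "K = p / (r * (1 - z * b))"
  ultimately have *: "(1 - a0) * K = b * (a0 - 1) / (a - b) * ((1 - z * a) * K) -
     a * (a0 - 1) / (a - b) * ((1 - z * b) * K)" by (simp only: left_diff_distrib mult.assoc)
  have e: "p / r = (1 - z * b) * K" "p * (1 - z * a) / (r * (1 - z * b)) = (1 - z * a) * K"
    using assms by (simp_all add: K_def)
  show ?thesis unfolding e K_def[symmetric] by (rule *)
qed

lemma frac_one:
  fixes z a b p r :: "'a :: field"
  assumes "a \<noteq> b" "1 - z * b \<noteq> 0" "r \<noteq> 0"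
  shows "(1 - z) * (p / (r * (1 - z * b))) =
    (1 - a) / (b - a) * (p / r) + (b - 1) / (b - a) * (p * (1 - z * a) / (r * (1 - z * b)))"
proof -
  have "1 - z = (1 - a) / (b - a) * (1 - z * b) + (b - 1) / (b - a) * (1 - z * a)"
    using assms(1) by (simp add: divide_simps) (simp add: algebra_simps)
  moreover define K where "K = p / (r * (1 - z * b))"
  ultimately have *: "(1 - z) * K = (1 - a) / (b - a) * ((1 - z * b) * K) +
     (b - 1) / (b - a) * ((1 - z * a) * K)" by (simp only: distrib_right mult.assoc)
  have e: "p / r = (1 - z * b) * K" "p * (1 - z * a) / (r * (1 - z * b)) = (1 - z * a) * K"
    using assms by (simp_all add: K_def)
  show ?thesis unfolding e K_def[symmetric] by (rule *)
qed

lemma prod_tperm_0: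
  fixes G :: "int \<Rightarrow> 'a :: comm_monoid_mult"
  assumes "1 \<le> m" "m \<le> n"
  shows "(\<Prod>l\<in>{1..m}. G (tperm n 0 (int l))) * G 1 = G 0 * (\<Prod>l\<in>{1..m}. G (int l))"
  using assms
proof (induction m rule: dec_induct)
  case base
  then show ?case using tperm_in[of 0 n 1] assms by simp
next
  case (step m)
  then have "tperm n 0 (int (Suc m)) = int (Suc m)" using tperm_in[of 0 n "int (Suc m)"] by simp
  then have "(\<Prod>l\<in>{1..Suc m}. G (tperm n 0 (int l))) * G 1 =
      ((\<Prod>l\<in>{1..m}. G (tperm n 0 (int l))) * G 1) * G (int (Suc m))" by (simp add: mult_ac)
  also have "(\<Prod>l\<in>{1..m}. G (tperm n 0 (int l))) * G 1 = G 0 * (\<Prod>l\<in>{1..m}. G (int l))"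
    using step by simp
  finally show ?case by (simp add: mult_ac)
qed

context qhyp
begin

lemma weight_ratio:
  assumes "qpoch_prod q A' (n + 1) k = qpoch_prod q A (n + 1) k * r" "qpoch_prod q B' (n + 1) k = qpoch_prod q B (n + 1) k * s"
  shows "weight n q A' B' c k = weight n q A B c k * (r / s)"
  unfolding weight_def assms by simp

lemma xcomp_tperm_0:
  assumes g: "generic n q A B c" and m: "m \<le> n"
  shows "xcomp n q (\<lambda>j. A (tperm n 0 j)) B c m =
    (if m = 0 then xcomp n q A B c 0 + (A 0 - A 1) / (A 1 - B 0) * q * c * xcomp n q A B c n
     else (A 0 - B 0) / (A 1 - B 0) * xcomp n q A B c m)"
proof -
  let ?A = "\<lambda>j. A (tperm n 0 j)"
  have A1: "1 - A l \<noteq> 0" and zA: "1 - q ^ k * A l \<noteq> 0" for l k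
    using generic_nonzero(1)[OF g, of 0 l] generic_nonzero(1)[OF g, of k l] by auto
  have An2: "A (int n + 2) = q * A 1"
    using g unfolding generic_def quasi_periodic_def by (metis add.commute add.left_commute of_nat_1 of_nat_add one_add_one)
  have t: "tperm n 0 (int n + 1) = int n + 2" using tperm_in[of 0 n "int n + 1"] n1 by simp
  have lin_prod: "lin_prod ?A m z * (1 - z * A 1) = (1 - z * A 0) * lin_prod A m z" if "1 \<le> m" "m \<le> n" for m z
    unfolding lin_prod_def using prod_tperm_0[OF that, of "\<lambda>l. 1 - z * A l"] .
  have qpoch_prod: "qpoch_prod q ?A (n + 1) k * ((1 - A 1) * (1 - q ^ k * A 0)) = qpoch_prod q A (n + 1) k * ((1 - A 0) * (1 - q ^ k * A 1))" for k
  proof -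
    have P: "qpoch_prod q ?A n k * qpoch (A 1) q k = qpoch (A 0) q k * qpoch_prod q A n k"
      unfolding qpoch_prod_def using prod_tperm_0[OF n1 order_refl, of "\<lambda>l. qpoch (A l) q k"] .
    have "qpoch_prod q ?A (n + 1) k * ((1 - A 1) * (1 - q ^ k * A 0)) =
        qpoch_prod q ?A n k * ((1 - A 1) * qpoch (q * A 1) q k) * (1 - q ^ k * A 0)"
      by (simp add: qpoch_prod_Suc t An2 mult_ac)
    also have "\<dots> = (qpoch_prod q ?A n k * qpoch (A 1) q k) * ((1 - q ^ k * A 0) * (1 - q ^ k * A 1))"
      unfolding qpoch_shift by (simp add: mult_ac)
    also have "\<dots> = qpoch_prod q A n k * (1 - q ^ k * A 1) * (qpoch (A 0) q k * (1 - q ^ k * A 0))"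
      unfolding P by (simp add: mult_ac)
    also have "\<dots> = qpoch_prod q A (n + 1) k * ((1 - A 0) * (1 - q ^ k * A 1))"
      unfolding qpoch_shift[symmetric] by (simp add: qpoch_prod_Suc genericD(1)[OF g] mult_ac)
    finally show ?thesis .
  qed
  have weight: "weight n q ?A B c k = weight n q A B c k * ((1 - A 0) / (1 - A 1) * ((1 - q ^ k * A 1) / (1 - q ^ k * A 0)))" for k
  proof -
    have "qpoch_prod q ?A (n + 1) k = qpoch_prod q A (n + 1) k * ((1 - A 0) / (1 - A 1) * ((1 - q ^ k * A 1) / (1 - q ^ k * A 0)))"
      using qpoch_prod[of k] A1[of 1] zA[of k 0] by (simp add: divide_simps)
    from weight_ratio[OF this, of B B 1 c] show ?thesis by simp
  qed
  show ?thesis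
  proof (cases "m = 0")
    case True
    have "weighted_sum n q ?A B c (\<lambda>z. 1) = weighted_sum n q A B c (\<lambda>z. 1 * 1 + (A 0 - A 1) / (A 1 - 1) * ((1 - z) / (1 - z * A 0)))"
      by (rule weighted_sum_cong) (simp only: weight frac_swap_0[OF A1 zA] mult_1_right)
    also have "\<dots> = 1 * weighted_sum n q A B c (\<lambda>z. 1) + (A 0 - A 1) / (A 1 - 1) * weighted_sum n q A B c (\<lambda>z. (1 - z) / (1 - z * A 0))"
      by (intro weighted_sum_lin g converges_along_intros)
    finally show ?thesis using True xcomp_top[OF g]
      by (simp add: xcomp_0 genericD(5)[OF g] distrib_left mult.assoc)
  next
    case False
    have "weighted_sum n q ?A B c (\<lambda>z. lin_prod ?A m z / lin_prod B m z) =
        weighted_sum n q A B c (\<lambda>z. (1 - A 0) / (1 - A 1) * (lin_prod A m z / lin_prod B m z))"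
    proof (rule weighted_sum_cong)
      fix k
      have "lin_prod ?A m (q ^ k) = (1 - q ^ k * A 0) * lin_prod A m (q ^ k) / (1 - q ^ k * A 1)"
        using lin_prod[of m "q ^ k"] False m zA[of k 1] by (simp add: divide_simps)
      then show "weight n q ?A B c k * (lin_prod ?A m (q ^ k) / lin_prod B m (q ^ k)) =
        weight n q A B c k * ((1 - A 0) / (1 - A 1) * (lin_prod A m (q ^ k) / lin_prod B m (q ^ k)))"
        using zA[of k 0] zA[of k 1] unfolding weight by simp
    qed
    also have "\<dots> = (1 - A 0) / (1 - A 1) * weighted_sum n q A B c (\<lambda>z. lin_prod A m z / lin_prod B m z)"
      by (intro weighted_sum_scale g converges_along_intros)
    also have "(1 - A 0) / (1 - A 1) = (A 0 - B 0) / (A 1 - B 0)"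
      unfolding genericD(5)[OF g] by (metis minus_diff_eq minus_divide_divide)
    finally show ?thesis using False by (simp add: xcomp_def)
  qed
qed

lemma qpoch_prod_shift_ratio:
  assumes g: "generic n q A B c"
  shows "qpoch_prod q (\<lambda>j. A (j - 1)) (n + 1) k * (1 - q ^ k * A 0) = (1 - A 0) * qpoch_prod q A (n + 1) k"
  using qpoch_prod_shift[of "n + 1" q A k] qpoch_shift[of "A 0" q k]
  by (simp add: qpoch_prod_Suc genericD(1)[OF g] mult_ac)

lemma xcomp_sigma:
  assumes g: "generic n q A B c" and m: "m \<le> n"
  shows "xcomp n q (\<lambda>j. A (j - 1)) B c m =
    (if m = 0 then xcomp n q A B c 0 - A (int n + 1) * c * xcomp n q A B c n
     else B (int m) * (A 0 - B 0) / (A (int m) - B (int m)) * xcomp n q A B c m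
       - A (int m) * (A 0 - B 0) / (A (int m) - B (int m)) * xcomp n q A B c (m - 1))"
proof -
  let ?A = "\<lambda>j. A (j - 1)"
  have zA: "1 - q ^ k * A l \<noteq> 0" for l k
    using generic_nonzero(1)[OF g, of k l] by auto
  have weight: "weight n q ?A B c k = weight n q A B c k * ((1 - A 0) / (1 - q ^ k * A 0))" for k
  proof -
    have "qpoch_prod q ?A (n + 1) k = qpoch_prod q A (n + 1) k * ((1 - A 0) / (1 - q ^ k * A 0))"
      using qpoch_prod_shift_ratio[OF g, of k] zA[of k 0] by (simp add: divide_simps mult_ac)
    from weight_ratio[OF this, of B B 1 c] show ?thesis by simp
  qed
  show ?thesis
  proof (cases "m = 0")
    case True
    have "weighted_sum n q ?A B c (\<lambda>z. 1) = weighted_sum n q A B c (\<lambda>z. 1 * 1 + (- A 0) * ((1 - z) / (1 - z * A 0)))"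
    proof (rule weighted_sum_cong)
      fix k
      have "(1 - A 0) / (1 - q ^ k * A 0) = 1 * 1 + (- A 0) * ((1 - q ^ k) / (1 - q ^ k * A 0))"
        using zA[of k 0] by (simp add: divide_simps) (simp add: algebra_simps)
      then show "weight n q ?A B c k * 1 = weight n q A B c k * (1 * 1 + (- A 0) * ((1 - q ^ k) / (1 - q ^ k * A 0)))"
        unfolding weight by simp
    qed
    also have "\<dots> = 1 * weighted_sum n q A B c (\<lambda>z. 1) + (- A 0) * weighted_sum n q A B c (\<lambda>z. (1 - z) / (1 - z * A 0))"
      by (intro weighted_sum_lin g converges_along_intros)
    finally have "xcomp n q ?A B c 0 = xcomp n q A B c 0 - A 0 * (q * c * xcomp n q A B c n)"
      unfolding xcomp_top[OF g] xcomp_0 by (simp add: right_diff_distrib mult_ac)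
    then show ?thesis using True by (simp add: genericD(1)[OF g] mult_ac)
  next
    case False
    then have m1: "m \<ge> 1" by simp
    let ?s = "B (int m) * (A 0 - 1) / (A (int m) - B (int m))"
    let ?t = "A (int m) * (A 0 - 1) / (A (int m) - B (int m))"
    have "weighted_sum n q ?A B c (\<lambda>z. lin_prod ?A m z / lin_prod B m z) =
        weighted_sum n q A B c (\<lambda>z. ?s * (lin_prod A m z / lin_prod B m z) + (- ?t) * (lin_prod A (m - 1) z / lin_prod B (m - 1) z))"
    proof (rule weighted_sum_cong)
      fix k
      have "(1 - A 0) / (1 - q ^ k * A 0) * (lin_prod ?A m (q ^ k) / lin_prod B m (q ^ k)) =
          (1 - A 0) * (lin_prod A (m - 1) (q ^ k) / lin_prod B m (q ^ k))"
        using zA[of k 0] unfolding lin_prod_shift[OF m1] by simp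
      also have "\<dots> = ?s * (lin_prod A m (q ^ k) / lin_prod B m (q ^ k)) + (- ?t) * (lin_prod A (m - 1) (q ^ k) / lin_prod B (m - 1) (q ^ k))"
        unfolding lin_prod_pos[OF m1]
        by (subst frac_sigma[of "A (int m)" "B (int m)"])
           (use genericD(8)[OF g] generic_nonzero(2)[OF g, of "int m" k] lin_prod_B_nonzero[OF g] m1 in auto)
      finally show "weight n q ?A B c k * (lin_prod ?A m (q ^ k) / lin_prod B m (q ^ k)) =
        weight n q A B c k * (?s * (lin_prod A m (q ^ k) / lin_prod B m (q ^ k)) + (- ?t) * (lin_prod A (m - 1) (q ^ k) / lin_prod B (m - 1) (q ^ k)))"
        unfolding weight by (simp only: mult.assoc)
    qed
    then have "xcomp n q ?A B c m = ?s * xcomp n q A B c m + (- ?t) * xcomp n q A B c (m - 1)"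
      unfolding xcomp_lin[OF g] by (simp add: xcomp_def)
    then show ?thesis using False by (simp add: genericD(5)[OF g])
  qed
qed

lemma xcomp_shift_both:
  assumes g: "generic n q A B c" and m: "m \<le> n"
  shows "xcomp n q (\<lambda>j. A (j - 1)) (\<lambda>j. B (tperm n (int n) (j - 1))) c m =
    (1 - A 0) / (1 - B (int n)) *
     (if m = 0 then (B (int n) - A (int n + 1)) / (B (int n + 1) - A (int n + 1)) * (q * c * xcomp n q A B c n)
        + (B (int n + 1) - B (int n)) / (B (int n + 1) - A (int n + 1)) * xcomp n q A B c 0
      else xcomp n q A B c (m - 1))"
proof -
  let ?A = "\<lambda>j. A (j - 1)"
  define B' where "B' = (\<lambda>j. B (tperm n (int n) j))"
  let ?B = "\<lambda>j. B' (j - 1)" and ?b = "B (- 1)"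
  have zA: "1 - q ^ k * A l \<noteq> 0" for l k
    using generic_nonzero(1)[OF g, of k l] by auto
  have A1: "1 - A l \<noteq> 0" for l
    using zA[of 0 l] by simp
  have zB: "1 - q ^ k * B l \<noteq> 0" if "l \<ge> 1" for l k
    using generic_nonzero(2)[OF g that, of k] by auto
  have b1: "1 - ?b \<noteq> 0" using genericD(5)[OF g] genericD(10)[OF g, of 0 "-1"] by auto
  have B1: "1 - B (int n) \<noteq> 0" using zB[of "int n" 0] n1 by simp
  have Bn: "B (int n) = q * ?b" by (rule genericD(4)[OF g])
  have B'0: "B' 0 = ?b" using tperm_in[of "int n" n 0] n1 by (simp add: B'_def)
  have lin_prod: "lin_prod ?B m z = (1 - z * ?b) * lin_prod B (m - 1) z" if "1 \<le> m" "m \<le> n" for m z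
  proof -
    have "lin_prod B' (m - 1) z = lin_prod B (m - 1) z"
      using lin_prod_tperm[of n n "m - 1" B z] that unfolding B'_def by auto
    then show ?thesis using lin_prod_shift[OF that(1), of B' z] by (simp add: B'0)
  qed
  have qpB: "qpoch_prod q ?B (n + 1) k * (1 - q ^ k * ?b) = (1 - ?b) * qpoch_prod q B (n + 1) k" for k
  proof -
    have "qpoch_prod q B' n k = qpoch_prod q B (n - 1) k * qpoch (B (int n + 1)) q k"
      unfolding qpoch_prod_def B'_def using prod_tperm[of n n n "\<lambda>l. qpoch (B l) q k"] n1 by simp
    moreover have "qpoch_prod q B n k = qpoch_prod q B (n - 1) k * qpoch (B (int n)) q k"
      using qpoch_prod_Suc[of q B "n - 1" k] n1 by simp
    ultimately have "qpoch_prod q ?B (n + 1) k * (1 - q ^ k * ?b) =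
       qpoch ?b q k * (1 - q ^ k * ?b) * qpoch_prod q B (n - 1) k * qpoch (B (int n + 1)) q k"
      using qpoch_prod_shift[of "n + 1" q B' k] by (simp add: B'0 mult_ac)
    then show ?thesis
      using \<open>qpoch_prod q B n k = _\<close> unfolding qpoch_shift[symmetric] by (simp add: qpoch_prod_Suc Bn mult_ac)
  qed
  have weight: "weight n q ?A ?B c k = weight n q A B c k *
     ((1 - A 0) / (1 - ?b) * ((1 - q ^ k * ?b) / (1 - q ^ k * A 0)))" if "1 - q ^ k * ?b \<noteq> 0" for k
  proof -
    have "qpoch_prod q ?A (n + 1) k = qpoch_prod q A (n + 1) k * ((1 - A 0) / (1 - q ^ k * A 0))"
      using qpoch_prod_shift_ratio[OF g, of k] zA[of k 0] by (simp add: divide_simps mult_ac)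
    moreover have "qpoch_prod q ?B (n + 1) k = qpoch_prod q B (n + 1) k * ((1 - ?b) / (1 - q ^ k * ?b))"
      using qpB[of k] that by (simp add: divide_simps mult_ac)
    ultimately have "weight n q ?A ?B c k = weight n q A B c k *
        ((1 - A 0) / (1 - q ^ k * A 0) / ((1 - ?b) / (1 - q ^ k * ?b)))" by (rule weight_ratio)
    then show ?thesis by (simp add: mult_ac)
  qed
  have zb: "1 - q ^ k * ?b \<noteq> 0" for k
    using zB[of "int n" "k - 1"] b1 n1 Bn by (cases k) (auto simp: mult_ac)
  have pre: "lin_prod ?B n 1 = (1 - ?b) / (1 - B (int n)) * lin_prod B n 1"
    using lin_prod[of n 1] lin_prod_pos[OF n1, of B 1] n1 B1 by simp
  have "xcomp n q ?A ?B c m = (1 - A 0) / (1 - B (int n)) *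
     (if m = 0 then (B (int n) - A (int n + 1)) / (B (int n + 1) - A (int n + 1)) * (q * c * xcomp n q A B c n)
        + (B (int n + 1) - B (int n)) / (B (int n + 1) - A (int n + 1)) * xcomp n q A B c 0
      else xcomp n q A B c (m - 1))"
  proof (cases "m = 0")
    case True
    let ?s = "(?b - A 0) / (1 - A 0)" and ?t = "(1 - ?b) / (1 - A 0)"
    have "weighted_sum n q ?A ?B c (\<lambda>z. 1) = weighted_sum n q A B c (\<lambda>z. ((1 - A 0) / (1 - ?b)) * (?s * ((1 - z) / (1 - z * A 0)) + ?t * 1))"
    proof (rule weighted_sum_cong)
      fix k
      have "(1 - q ^ k * ?b) / (1 - q ^ k * A 0) = ?s * ((1 - q ^ k) / (1 - q ^ k * A 0)) + ?t * 1"
        using A1[of 0] zA[of k 0] by (simp add: divide_simps) (simp add: algebra_simps)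
      then show "weight n q ?A ?B c k * 1 = weight n q A B c k * (((1 - A 0) / (1 - ?b)) * (?s * ((1 - q ^ k) / (1 - q ^ k * A 0)) + ?t * 1))"
        unfolding weight[OF zb] by simp
    qed
    also have "\<dots> = weighted_sum n q A B c (\<lambda>z. ((1 - A 0) / (1 - ?b) * ?s) * ((1 - z) / (1 - z * A 0)) + ((1 - A 0) / (1 - ?b) * ?t) * 1)"
      by (simp only: distrib_left mult.assoc)
    also have "\<dots> = ((1 - A 0) / (1 - ?b) * ?s) * weighted_sum n q A B c (\<lambda>z. ((1 - z) / (1 - z * A 0))) + ((1 - A 0) / (1 - ?b) * ?t) * weighted_sum n q A B c (\<lambda>z. 1)"
      by (intro weighted_sum_lin g converges_along_intros)
    also have "\<dots> = (1 - A 0) / (1 - ?b) * (?s * weighted_sum n q A B c (\<lambda>z. ((1 - z) / (1 - z * A 0))) + ?t * weighted_sum n q A B c (\<lambda>z. 1))"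
      by (simp only: distrib_left mult.assoc)
    finally have "xcomp n q ?A ?B c 0 = lin_prod ?B n 1 * ((1 - A 0) / (1 - ?b)) * (?s * weighted_sum n q A B c (\<lambda>z. ((1 - z) / (1 - z * A 0))) + ?t * weighted_sum n q A B c (\<lambda>z. 1))"
      by (simp only: xcomp_0 mult.assoc)
    also have "lin_prod ?B n 1 * ((1 - A 0) / (1 - ?b)) = (1 - A 0) / (1 - B (int n)) * lin_prod B n 1"
      unfolding pre using b1 by simp
    finally have "xcomp n q ?A ?B c 0 = (1 - A 0) / (1 - B (int n)) * (?s * (q * c * xcomp n q A B c n) + ?t * xcomp n q A B c 0)"
      unfolding xcomp_top[OF g] xcomp_0 by (simp only: distrib_left mult_ac)
    moreover have "?s = (B (int n) - A (int n + 1)) / (B (int n + 1) - A (int n + 1))"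
      unfolding genericD(1,2,4)[OF g]
    proof -
      have "(q * ?b - q * A 0) / (q - q * A 0) = (q * (?b - A 0)) / (q * (1 - A 0))"
        by (simp add: right_diff_distrib)
      then show "?s = (q * ?b - q * A 0) / (q - q * A 0)" using q0 by simp
    qed
    moreover have "?t = (B (int n + 1) - B (int n)) / (B (int n + 1) - A (int n + 1))"
      unfolding genericD(1,2,4)[OF g]
    proof -
      have "(q - q * ?b) / (q - q * A 0) = (q * (1 - ?b)) / (q * (1 - A 0))"
        by (simp add: right_diff_distrib)
      then show "?t = (q - q * ?b) / (q - q * A 0)" using q0 by simp
    qed
    ultimately show ?thesis using True by simp
  next
    case False
    then have m1: "m \<ge> 1" by simp
    have "weighted_sum n q ?A ?B c (\<lambda>z. lin_prod ?A m z / lin_prod ?B m z) =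
        weighted_sum n q A B c (\<lambda>z. (1 - A 0) / (1 - ?b) * (lin_prod A (m - 1) z / lin_prod B (m - 1) z))"
      by (rule weighted_sum_cong) (use zb zA in \<open>simp add: weight[OF zb] lin_prod[OF m1 m] lin_prod_shift[OF m1]\<close>)
    also have "\<dots> = (1 - A 0) / (1 - ?b) * weighted_sum n q A B c (\<lambda>z. lin_prod A (m - 1) z / lin_prod B (m - 1) z)"
      by (intro weighted_sum_scale g converges_along_intros)
    finally show ?thesis using False b1 unfolding xcomp_def[of _ _ _ ?B] pre
      by (simp add: xcomp_def)
  qed
  then show ?thesis by (simp add: B'_def)
qed

text \<open>The components reached in the middle of the word for j = n + 1; the factor 1 - z kills
  the term k = 0, so that an index shift turns them into a genuine \<^const>\<open>xcomp\<close>.\<close>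

definition xcomp_shift :: "(int \<Rightarrow> complex) \<Rightarrow> (int \<Rightarrow> complex) \<Rightarrow> complex \<Rightarrow> nat \<Rightarrow> complex" where
  "xcomp_shift A B c m = lin_prod B n 1 * weighted_sum n q A B c (\<lambda>z. (1 - z) / (1 - z * A 0) * (lin_prod (\<lambda>j. A (j - 1)) m z / lin_prod B m z))"

lemma xcomp_shift_0:
  assumes g: "generic n q A B c"
  shows "xcomp_shift A B c 0 = q * c * xcomp n q A B c n"
  unfolding xcomp_top[OF g] by (simp add: xcomp_shift_def)

lemma xcomp_shift_pos:
  assumes g: "generic n q A B c" and m: "1 \<le> m"
  shows "xcomp_shift A B c m = (1 - A (int m)) / (B (int m) - A (int m)) * xcomp n q A B c (m - 1) +
    (B (int m) - 1) / (B (int m) - A (int m)) * xcomp n q A B c m"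
proof -
  have "(1 - q ^ k) / (1 - q ^ k * A 0) * (lin_prod (\<lambda>j. A (j - 1)) m (q ^ k) / lin_prod B m (q ^ k)) =
    (1 - A (int m)) / (B (int m) - A (int m)) * (lin_prod A (m - 1) (q ^ k) / lin_prod B (m - 1) (q ^ k)) +
    (B (int m) - 1) / (B (int m) - A (int m)) * (lin_prod A m (q ^ k) / lin_prod B m (q ^ k))" for k
  proof -
    have "(1 - q ^ k) / (1 - q ^ k * A 0) * (lin_prod (\<lambda>j. A (j - 1)) m (q ^ k) / lin_prod B m (q ^ k)) =
       (1 - q ^ k) * (lin_prod A (m - 1) (q ^ k) / lin_prod B m (q ^ k))"
      using generic_nonzero(1)[OF g, of k 0] unfolding lin_prod_shift[OF m] by simp
    then show ?thesis
      using frac_one[of "A (int m)" "B (int m)" "q ^ k" "lin_prod B (m - 1) (q ^ k)" "lin_prod A (m - 1) (q ^ k)"]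
        genericD(8)[OF g] generic_nonzero(2)[OF g, of "int m" k] lin_prod_B_nonzero[OF g] m
      unfolding lin_prod_pos[OF m] by simp
  qed
  then show ?thesis unfolding xcomp_shift_def xcomp_lin[OF g] by (simp only: weighted_sum_def)
qed

lemma xcomp_shift_eq_xcomp:
  assumes g: "generic n q A B c" and g': "generic n q (\<lambda>j. q * A (j - 1)) B' c"
    and B': "\<And>l. 1 \<le> l \<Longrightarrow> l \<le> int n \<Longrightarrow> B' l = q * B l" and m: "m \<le> n"
  shows "xcomp_shift A B c m = q * c * lin_prod A n 1 / lin_prod B' n 1 * xcomp n q (\<lambda>j. q * A (j - 1)) B' c m"
proof -
  let ?A = "\<lambda>j. q * A (j - 1)"
  have B'n: "lin_prod B' m z = lin_prod B m (q * z)" if "m \<le> n" for m z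
    unfolding lin_prod_scale[symmetric] using B' that by (auto intro: lin_prod_cong)
  have qpB: "qpoch_prod q B' (n + 1) k = qpoch_prod q (\<lambda>j. q * B j) n k * qpoch q q k" for k
    using qpoch_prod_cong[of n B' "\<lambda>j. q * B j" q k] B' by (simp add: qpoch_prod_Suc genericD(2)[OF g'])
  have qpA: "qpoch_prod q ?A (n + 1) k = qpoch (q * A 0) q k * qpoch_prod q (\<lambda>j. q * A j) n k" for k
    using qpoch_prod_shift[of "n + 1" q "\<lambda>j. q * A j" k] by simp
  have weight: "lin_prod B n 1 * (weight n q A B c k * (lin_prod A n (q ^ k) / lin_prod B n (q ^ k))) = lin_prod A n 1 * weight n q ?A B' c k" for k
  proof -
    have "lin_prod A n 1 * qpoch_prod q ?A (n + 1) k = qpoch_prod q A (n + 1) k * lin_prod A n (q ^ k)"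
      unfolding qpA using qpoch_prod_scale[of A n q k] by (simp add: qpoch_prod_Suc genericD(1)[OF g] mult_ac)
    moreover have "lin_prod B n 1 * qpoch_prod q B' (n + 1) k = qpoch_prod q B (n + 1) k * lin_prod B n (q ^ k)"
      unfolding qpB using qpoch_prod_scale[of B n q k] by (simp add: qpoch_prod_Suc genericD(2)[OF g] mult_ac)
    ultimately have "lin_prod A n 1 * qpoch_prod q ?A (n + 1) k / (lin_prod B n 1 * qpoch_prod q B' (n + 1) k) =
        qpoch_prod q A (n + 1) k * lin_prod A n (q ^ k) / (qpoch_prod q B (n + 1) k * lin_prod B n (q ^ k))" by simp
    moreover have "lin_prod A n 1 * weight n q ?A B' c k =
        (q * c) ^ k * lin_prod B n 1 * (lin_prod A n 1 * qpoch_prod q ?A (n + 1) k / (lin_prod B n 1 * qpoch_prod q B' (n + 1) k))"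
      using lin_prod_B_nonzero'[OF g, of n] by (simp add: weight_def)
    ultimately show ?thesis by (simp add: weight_def mult_ac)
  qed
  let ?f = "\<lambda>z. lin_prod (\<lambda>j. A (j - 1)) m z / lin_prod B m z"
  have f: "?f (q ^ Suc k) = lin_prod ?A m (q ^ k) / lin_prod B' m (q ^ k)" for k
    unfolding B'n[OF m] lin_prod_scale[of q "\<lambda>j. A (j - 1)"] by simp
  have "xcomp_shift A B c m = lin_prod B n 1 * (\<Sum>k. q * c * weight n q A B c k * (lin_prod A n (q ^ k) / lin_prod B n (q ^ k)) * ?f (q ^ Suc k))"
    unfolding xcomp_shift_def by (subst weighted_sum_step[OF g]) (auto intro: converges_along_intros)
  also have "(\<Sum>k. q * c * weight n q A B c k * (lin_prod A n (q ^ k) / lin_prod B n (q ^ k)) * ?f (q ^ Suc k)) =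
     (\<Sum>k. weight n q ?A B' c k * ((q * c * lin_prod A n 1 / lin_prod B n 1) * (lin_prod ?A m (q ^ k) / lin_prod B' m (q ^ k))))"
  proof (rule suminf_cong)
    fix k
    have e: "weight n q A B c k * (lin_prod A n (q ^ k) / lin_prod B n (q ^ k)) = weight n q ?A B' c k * (lin_prod A n 1 / lin_prod B n 1)"
      using weight[of k] lin_prod_B_nonzero'[OF g, of n] by (simp add: field_simps)
    then show "q * c * weight n q A B c k * (lin_prod A n (q ^ k) / lin_prod B n (q ^ k)) * ?f (q ^ Suc k) =
      weight n q ?A B' c k * ((q * c * lin_prod A n 1 / lin_prod B n 1) * (lin_prod ?A m (q ^ k) / lin_prod B' m (q ^ k)))"
      unfolding f mult.assoc[of "q * c"] e by simp
  qed
  also have "\<dots> = (q * c * lin_prod A n 1 / lin_prod B n 1) * weighted_sum n q ?A B' c (\<lambda>z. lin_prod ?A m z / lin_prod B' m z)"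
    using weighted_sum_scale[OF g' converges_along_quotient, of "q * c * lin_prod A n 1 / lin_prod B n 1" ?A m B' m] by (simp only: weighted_sum_def)
  finally show ?thesis
    using lin_prod_B_nonzero'[OF g, of n] lin_prod_B_nonzero'[OF g', of n] by (simp add: xcomp_def)
qed

end

subsection \<open>Action of the matrices\<close>

text \<open>Coordinates are reversed to match the indexing of \<^const>\<open>xcomp\<close>.\<close>

definition rev_vec :: "nat \<Rightarrow> (nat \<Rightarrow> complex) \<Rightarrow> complex vec" where
  "rev_vec n f = vec (n + 1) (\<lambda>r. f (n - r))"

lemma rev_vec_cong: "(\<And>m. m \<le> n \<Longrightarrow> f m = g m) \<Longrightarrow> rev_vec n f = rev_vec n g"
  by (auto simp: rev_vec_def)

lemma smult_rev_vec: "s \<cdot>\<^sub>v rev_vec n f = rev_vec n (\<lambda>m. s * f m)"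
  by (auto simp: rev_vec_def)

lemma smult_mat_rev_vec:
  assumes "M \<in> carrier_mat (n + 1) (n + 1)" "M *\<^sub>v rev_vec n f = rev_vec n g"
  shows "(s \<cdot>\<^sub>m M) *\<^sub>v rev_vec n f = rev_vec n (\<lambda>m. s * g m)"
proof -
  have "(s \<cdot>\<^sub>m M) *\<^sub>v rev_vec n f = s \<cdot>\<^sub>v (M *\<^sub>v rev_vec n f)"
    using assms(1) by (intro eq_vecI) (auto simp: rev_vec_def scalar_prod_def sum_distrib_left distrib_left mult_ac)
  then show ?thesis by (simp add: assms(2) smult_rev_vec)
qed

lemma mat_rev_vec:
  fixes d e :: "nat \<Rightarrow> complex"
  assumes F: "\<And>m k. m \<le> n \<Longrightarrow> k \<le> n \<Longrightarrow>
      F (n - m, n - k) = (if k = m then d m else 0) + (if k = u m then e m else 0)"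
    and u: "\<And>m. m \<le> n \<Longrightarrow> u m \<le> n"
  shows "mat (n + 1) (n + 1) F *\<^sub>v rev_vec n f = rev_vec n (\<lambda>m. d m * f m + e m * f (u m))"
proof (rule eq_vecI)
  fix r assume "r < dim_vec (rev_vec n (\<lambda>m. d m * f m + e m * f (u m)))"
  then have r: "r \<le> n" by (simp add: rev_vec_def)
  define m where "m = n - r"
  have m: "m \<le> n" "r = n - m" using r by (auto simp: m_def)
  have "(mat (n + 1) (n + 1) F *\<^sub>v rev_vec n f) $ r = (\<Sum>s\<in>{0..<n+1}. F (r, s) * f (n - s))"
    using r by (simp add: scalar_prod_def rev_vec_def)
  also have "\<dots> = (\<Sum>k\<in>{0..<n+1}. F (n - m, n - k) * f k)"
    unfolding m(2) by (rule sum.reindex_bij_witness[of _ "\<lambda>k. n - k" "\<lambda>k. n - k"]) auto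
  also have "\<dots> = (\<Sum>k\<in>{0..<n+1}. (if k = m then d m * f m else 0) + (if k = u m then e m * f (u m) else 0))"
    using m F by (intro sum.cong) (auto simp: distrib_right)
  also have "\<dots> = d m * f m + e m * f (u m)"
    using m u[OF m(1)] by (simp add: sum.distrib)
  finally show "(mat (n + 1) (n + 1) F *\<^sub>v rev_vec n f) $ r = rev_vec n (\<lambda>m. d m * f m + e m * f (u m)) $ r"
    using r by (simp add: rev_vec_def m_def)
qed (simp add: rev_vec_def)

lemma Mlet_carrier: "Mlet n q lc lq lg w X \<in> carrier_mat (n + 1) (n + 1)"
  by (cases w) (simp_all add: Let_def)

lemma wmat_carrier: "wmat n q lc lq lg ws X \<in> carrier_mat (n + 1) (n + 1)"
proof (induction ws arbitrary: X)
  case (Cons w ws)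
  then show ?case unfolding wmat.simps by (rule mult_carrier_mat[OF _ Mlet_carrier])
qed simp

lemma act_append: "act n q (u @ v) X = act n q v (act n q u X)"
  by (induction u arbitrary: X) auto

lemma wmat_append: "wmat n q lc lq lg (u @ v) X = wmat n q lc lq lg v (act n q u X) * wmat n q lc lq lg u X"
proof (induction u arbitrary: X)
  case (Cons w u)
  show ?case
    unfolding append_Cons wmat.simps act.simps Cons.IH
    by (rule assoc_mult_mat[OF wmat_carrier wmat_carrier Mlet_carrier])
next
  case Nil
  show ?case unfolding append_Nil wmat.simps act.simps by (rule right_mult_one_mat[OF wmat_carrier, symmetric])
qed

lemma Mlet_P_rev_vec:
  fixes X :: par and q :: complex and n :: nat
  assumes i: "1 \<le> i" "i \<le> n" and i0: "i0 mod (int n + 1) = int i"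
  defines "a \<equiv> Aof n q X" and "b \<equiv> Bof n q X"
  shows "Mlet n q lc lq lg (P i0) X *\<^sub>v rev_vec n f = rev_vec n (\<lambda>m.
    if m = i then (a (int i + 1) - b (int i)) / (a (int i) - b (int i)) * f i
       + (a (int i) - a (int i + 1)) / (a (int i) - b (int i)) * f (i - 1)
     else f m)"
proof -
  have "Mlet n q lc lq lg (P i0) X *\<^sub>v rev_vec n f = rev_vec n (\<lambda>m.
      (if m = i then (a (int i + 1) - b (int i)) / (a (int i) - b (int i)) else 1) * f m
       + (if m = i then (a (int i) - a (int i + 1)) / (a (int i) - b (int i)) else 0) * f (m - 1))"
    unfolding Mlet.simps Let_def i0
  proof (subst if_not_P, use i in simp, rule mat_rev_vec[where u = "\<lambda>m. m - 1"], goal_cases)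
    case (1 m k)
    have "int (n - m) + 1 = int (n - k) + 1 \<longleftrightarrow> k = m" "1 \<le> int (n - m) + 1"
      "int (n - m) + 1 \<le> int n + 1" "int (n - m) + 1 \<le> int n - int i \<longleftrightarrow> i < m"
      "int (n - m) + 1 = int n - int i + 1 \<longleftrightarrow> m = i"
      "int n - int i + 2 \<le> int (n - m) + 1 \<longleftrightarrow> m < i"
      "int (n - k) + 1 = int n - int i + 2 \<longleftrightarrow> k = i - 1"
      using 1 i by linarith+
    then show ?case by (simp only: split_conv a_def b_def) (cases "m = i"; simp)
  qed (use i in auto)
  also have "\<dots> = rev_vec n (\<lambda>m.
    if m = i then (a (int i + 1) - b (int i)) / (a (int i) - b (int i)) * f i
       + (a (int i) - a (int i + 1)) / (a (int i) - b (int i)) * f (i - 1)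
     else f m)" by (rule rev_vec_cong) simp
  finally show ?thesis .
qed

lemma Mlet_P0_rev_vec:
  fixes X :: par and q :: complex and n :: nat
  assumes i0: "i0 mod (int n + 1) = 0"
  defines "a \<equiv> Aof n q X" and "b \<equiv> Bof n q X"
  shows "Mlet n q lc lq lg (P i0) X *\<^sub>v rev_vec n f = rev_vec n (\<lambda>m.
    if m = 0 then f 0 + (a 0 - a 1) / (a 1 - b 0) * q * Cof X * f n
     else (a 0 - b 0) / (a 1 - b 0) * f m)"
proof -
  have "Mlet n q lc lq lg (P i0) X *\<^sub>v rev_vec n f = rev_vec n (\<lambda>m.
      (if m = 0 then 1 else (a 0 - b 0) / (a 1 - b 0)) * f m
       + (if m = 0 then (a 0 - a 1) / (a 1 - b 0) * q * Cof X else 0) * f n)"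
    unfolding Mlet.simps Let_def i0
  proof (subst if_P, simp, rule mat_rev_vec[where u = "\<lambda>m. n"], goal_cases)
    case (1 m k)
    have "int (n - m) + 1 = int (n - k) + 1 \<longleftrightarrow> k = m" "1 \<le> int (n - m) + 1"
      "int (n - m) + 1 \<le> int n + 1" "int (n - m) + 1 \<le> int n \<longleftrightarrow> m \<noteq> 0"
      "int (n - m) + 1 = int n + 1 \<longleftrightarrow> m = 0" "int (n - k) + 1 = 1 \<longleftrightarrow> k = n"
      using 1 by linarith+
    then show ?case by (simp only: split_conv a_def b_def) (cases "m = 0"; simp)
  qed auto
  also have "\<dots> = rev_vec n (\<lambda>m.
    if m = 0 then f 0 + (a 0 - a 1) / (a 1 - b 0) * q * Cof X * f n
     else (a 0 - b 0) / (a 1 - b 0) * f m)" by (rule rev_vec_cong) simp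
  finally show ?thesis .
qed

lemma Mlet_P'_rev_vec:
  fixes X :: par and q :: complex and n :: nat
  assumes i: "1 \<le> i" "i < n"
  defines "a \<equiv> Aof n q X" and "b \<equiv> Bof n q X"
  shows "Mlet n q lc lq lg (P' i) X *\<^sub>v rev_vec n f = rev_vec n (\<lambda>m.
    if m = i then (b (int i) - a (int i + 1)) / (b (int i + 1) - a (int i + 1)) * f i
       + (b (int i + 1) - b (int i)) / (b (int i + 1) - a (int i + 1)) * f (i + 1)
     else f m)"
proof -
  have "Mlet n q lc lq lg (P' i) X *\<^sub>v rev_vec n f = rev_vec n (\<lambda>m.
      (if m = i then (b (int i) - a (int i + 1)) / (b (int i + 1) - a (int i + 1)) else 1) * f m
       + (if m = i then (b (int i + 1) - b (int i)) / (b (int i + 1) - a (int i + 1)) else 0) * f (if m = i then i + 1 else m))"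
    unfolding Mlet.simps Let_def
  proof (subst if_not_P, use i in simp, rule mat_rev_vec[where u = "\<lambda>m. if m = i then i + 1 else m"], goal_cases)
    case (1 m k)
    have "int (n - m) + 1 = int (n - k) + 1 \<longleftrightarrow> k = m" "1 \<le> int (n - m) + 1"
      "int (n - m) + 1 \<le> int n + 1" "int (n - m) + 1 \<le> int n - int i \<longleftrightarrow> i < m"
      "int (n - m) + 1 = int n - int i + 1 \<longleftrightarrow> m = i"
      "int n - int i + 2 \<le> int (n - m) + 1 \<longleftrightarrow> m < i"
      "int (n - k) + 1 = int n - int i \<longleftrightarrow> k = i + 1"
      using 1 i by linarith+
    then show ?case by (simp only: split_conv a_def b_def) (cases "m = i"; simp)
  qed (use i in auto)
  also have "\<dots> = rev_vec n (\<lambda>m.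
    if m = i then (b (int i) - a (int i + 1)) / (b (int i + 1) - a (int i + 1)) * f i
       + (b (int i + 1) - b (int i)) / (b (int i + 1) - a (int i + 1)) * f (i + 1)
     else f m)" by (rule rev_vec_cong) simp
  finally show ?thesis .
qed

lemma Mlet_P'n_rev_vec:
  fixes X :: par and q :: complex and n :: nat
  assumes n: "1 \<le> n"
  defines "a \<equiv> Aof n q X" and "b \<equiv> Bof n q X"
  shows "Mlet n q lc lq lg (P' n) X *\<^sub>v rev_vec n f = rev_vec n (\<lambda>m. cpw lc lq lg (inverse q * b (int n)) *
    (if m = n then (b (int n) - a (int n + 1)) / (b (int n + 1) - a (int n + 1)) * f n
       + (b (int n + 1) - b (int n)) / (b (int n + 1) - a (int n + 1)) * inverse q * inverse (Cof X) * f 0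
     else f m))"
  unfolding Mlet.simps Let_def b_def[symmetric] a_def[symmetric]
proof (subst if_P[OF refl], rule smult_mat_rev_vec[OF _ trans[OF mat_rev_vec[where
         d = "\<lambda>m. if m = n then (b (int n) - a (int n + 1)) / (b (int n + 1) - a (int n + 1)) else 1"
         and e = "\<lambda>m. if m = n then (b (int n + 1) - b (int n)) / (b (int n + 1) - a (int n + 1)) * inverse q * inverse (Cof X) else 0"
         and u = "\<lambda>m. 0"] rev_vec_cong]], goal_cases)
  case (2 m k)
  have "int (n - m) + 1 = int (n - k) + 1 \<longleftrightarrow> k = m" "int (n - m) + 1 = 1 \<longleftrightarrow> m = n"
    "2 \<le> int (n - m) + 1 \<longleftrightarrow> m < n" "int (n - m) + 1 \<le> int n + 1"
    "int (n - k) + 1 = int n + 1 \<longleftrightarrow> k = 0"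
    using 2 n by linarith+
  then show ?case by (simp only: split_conv) (cases "m = n"; use 2 in simp)
qed (use n in auto)

lemma Mlet_Sig_rev_vec:
  fixes X :: par and q :: complex and n :: nat
  defines "a \<equiv> Aof n q X" and "b \<equiv> Bof n q X"
  assumes ab: "a 0 \<noteq> b 0"
  shows "Mlet n q lc lq lg Sig X *\<^sub>v rev_vec n f = rev_vec n (\<lambda>m.
    if m = 0 then b 0 * f 0 - a (int n + 1) * Cof X * f n
     else b (int m) * (a 0 - b 0) / (a (int m) - b (int m)) * f m
       - a (int m) * (a 0 - b 0) / (a (int m) - b (int m)) * f (m - 1))"
  unfolding Mlet.simps Let_def b_def[symmetric] a_def[symmetric]
proof (rule trans[OF mat_rev_vec[where d = "\<lambda>m. b (int m) * (a 0 - b 0) / (a (int m) - b (int m))"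
         and e = "\<lambda>m. if m = 0 then - (a (int n + 1) * Cof X) else - (a (int m) * (a 0 - b 0) / (a (int m) - b (int m)))"
         and u = "\<lambda>m. if m = 0 then n else m - 1"] rev_vec_cong], goal_cases)
  case (1 m k)
  have "int n - (int (n - m) + 1) + 1 = int m" "int (n - m) + 1 = int (n - k) + 1 \<longleftrightarrow> k = m"
    "1 \<le> int (n - m) + 1" "int (n - m) + 1 \<le> int n + 1"
    "int (n - k) + 1 = int (n - m) + 1 + 1 \<longleftrightarrow> m \<noteq> 0 \<and> k = m - 1"
    "int (n - m) + 1 \<le> int n \<longleftrightarrow> m \<noteq> 0"
    "int (n - m) + 1 = int n + 1 \<longleftrightarrow> m = 0" "int (n - k) + 1 = 1 \<longleftrightarrow> k = n"
    using 1 by linarith+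
  then show ?case by (simp only: split_conv) (cases "m = 0"; simp)
qed (use ab in auto)

lemma Mlet_Pi1_rev_vec:
  fixes X :: par and q :: complex and n :: nat
  defines "b \<equiv> Bof n q X"
  shows "Mlet n q lc lq lg Pi1 X *\<^sub>v rev_vec n f = rev_vec n (\<lambda>m. cpw lc lq lg (inverse q * b (int n)) *
    (if m = 0 then q * Cof X * f n else f (m - 1)))"
  unfolding Mlet.simps Let_def b_def[symmetric]
proof (rule smult_mat_rev_vec[OF _ trans[OF mat_rev_vec[where d = "\<lambda>m. 0"
         and e = "\<lambda>m. if m = 0 then q * Cof X else 1"
         and u = "\<lambda>m. if m = 0 then n else m - 1"] rev_vec_cong]], goal_cases)
  case (2 m k)
  have "1 \<le> int (n - m) + 1"
    "int (n - k) + 1 = int (n - m) + 1 + 1 \<longleftrightarrow> m \<noteq> 0 \<and> k = m - 1"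
    "int (n - m) + 1 \<le> int n \<longleftrightarrow> m \<noteq> 0"
    "int (n - m) + 1 = int n + 1 \<longleftrightarrow> m = 0" "int (n - k) + 1 = 1 \<longleftrightarrow> k = n"
    using 2 by linarith+
  then show ?case by (simp only: split_conv) (cases "m = 0"; simp)
qed auto

lemma quasi_periodic_add_mult_int:
  assumes "quasi_periodic n q g" "q \<noteq> 0"
  shows "g (j + d * int (n + 1)) = q powi d * g j"
proof (cases "d \<ge> 0")
  case True
  then obtain k where "d = int k" using nonneg_eq_int by blast
  then show ?thesis using quasi_periodic_add_mult[OF assms(1), of j k] by simp
next
  case False
  then obtain k where k: "d = - int k" by (metis linorder_le_cases nonpos_int_cases)
  have "g (j + d * int (n + 1) + int k * int (n + 1)) = q ^ k * g (j + d * int (n + 1))"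
    by (rule quasi_periodic_add_mult[OF assms(1)])
  then show ?thesis using assms(2) by (simp add: k power_int_minus field_simps)
qed

lemma quasi_periodic_qext: "q \<noteq> 0 \<Longrightarrow> quasi_periodic n q (qext n q f)"
  unfolding quasi_periodic_def
proof
  fix j assume q: "q \<noteq> 0"
  have "j + int (n + 1) - 1 = (j - 1) + int (n + 1)" by simp
  then have "(j + int (n + 1) - 1) div int (n + 1) = (j - 1) div int (n + 1) + 1"
    "(j + int (n + 1) - 1) mod int (n + 1) = (j - 1) mod int (n + 1)"
    by (metis div_add_self2 of_nat_0_eq_iff add_is_0 one_neq_zero, metis mod_add_self2)
  then show "qext n q f (j + int (n + 1)) = q * qext n q f j"
    unfolding qext_def using q by (simp add: power_int_add)
qed

lemma qext_eq:
  assumes "quasi_periodic n q g" "q \<noteq> 0" "\<And>j. 1 \<le> j \<Longrightarrow> j \<le> int n + 1 \<Longrightarrow> f j = g j"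
  shows "qext n q f = g"
proof
  fix j
  let ?d = "(j - 1) div int (n + 1)" and ?r = "(j - 1) mod int (n + 1)"
  have "0 \<le> ?r" "?r < int (n + 1)" by (simp_all del: of_nat_add of_nat_Suc)
  then have "f (?r + 1) = g (?r + 1)" by (intro assms(3)) linarith+
  then have "qext n q f j = g (?r + 1 + ?d * int (n + 1))"
    unfolding qext_def quasi_periodic_add_mult_int[OF assms(1,2)] by simp
  also have "?r + 1 + ?d * int (n + 1) = j"
    using div_mult_mod_eq[of "j - 1" "int (n + 1)"] by linarith
  finally show "qext n q f j = g j" .
qed

lemma qext_in: "1 \<le> j \<Longrightarrow> j \<le> int n + 1 \<Longrightarrow> qext n q f j = f j"
  by (simp add: qext_def)

subsection \<open>Words in the letters\<close>

lemma shift_equivariant_comp_minus: "shift_equivariant n t \<Longrightarrow> shift_equivariant n (\<lambda>j. t (j - 1))"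
  unfolding shift_equivariant_def
proof
  fix j assume *: "\<forall>j. t (j + int (n + 1)) = t j + int (n + 1)"
  have "j + int (n + 1) - 1 = (j - 1) + int (n + 1)" by simp
  then show "t (j + int (n + 1) - 1) = t (j - 1) + int (n + 1)" using * by metis
qed

lemma prod_split:
  fixes g :: "nat \<Rightarrow> 'a :: comm_monoid_mult"
  assumes "m \<le> k"
  shows "prod g {1..k} = prod g {1..m} * prod g {m + 1..k}"
  using prod.ub_add_nat[of 1 m g "k - m"] assms by simp

lemma shift_equivariant_id: "shift_equivariant n (\<lambda>j. j)"
  by (simp add: shift_equivariant_def)

lemma tperm_mod: "tperm n (i mod (int n + 1)) = tperm n i"
proof -
  have N: "int n + 1 = int (n + 1)" by simp
  show ?thesis unfolding N by (rule ext) (simp only: tperm_def mod_add_left_eq mod_mod_trivial)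
qed

lemma quasi_periodic_comp:
  assumes "quasi_periodic n q A" "shift_equivariant n t"
  shows "quasi_periodic n q (\<lambda>j. s * A (t j))"
  using assms unfolding quasi_periodic_def shift_equivariant_def by (simp del: of_nat_add)

context qhyp
begin

lemma generic_comp:
  assumes g: "generic n q A B c" and t: "shift_equivariant n t" "shift_equivariant n t'" "inj t'" and s: "s * B (t' 0) = 1"
  shows "generic n q (\<lambda>j. s * A (t j)) (\<lambda>j. s * B (t' j)) c"
proof -
  have "s \<noteq> 0" using s by auto
  moreover have "inj B" using g by (simp add: generic_def)
  ultimately have "inj (\<lambda>j. s * B (t' j))" using t(3) by (auto simp: inj_def)
  then show ?thesis using g t s \<open>s \<noteq> 0\<close> by (simp add: generic_def quasi_periodic_comp)
qed

definition admissible :: "par \<Rightarrow> bool" where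
  "admissible X \<longleftrightarrow> generic n q (Aof n q X) (Bof n q X) (Cof X)"

lemma Aof_eq: "quasi_periodic n q g \<Longrightarrow> (\<And>j. fst X j = g j) \<Longrightarrow> Aof n q X = g"
  unfolding Aof_def by (rule qext_eq) (auto simp: q0)

lemma Bof_eq:
  assumes "quasi_periodic n q g" "g 0 = 1" "\<And>j. fst (snd X) j = g j"
  shows "Bof n q X = g"
proof -
  have "g (int n + 1) = q" using assms(1,2) unfolding quasi_periodic_def by (metis add_0 mult.right_neutral of_nat_1 of_nat_add)
  then show ?thesis unfolding Bof_def using assms by (intro qext_eq) (auto simp: q0)
qed

lemma quasi_periodic_Aof: "quasi_periodic n q (Aof n q X)"
  unfolding Aof_def by (rule quasi_periodic_qext[OF q0])

lemma quasi_periodic_Bof: "quasi_periodic n q (Bof n q X)"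
  unfolding Bof_def by (rule quasi_periodic_qext[OF q0])

lemma state_P:
  "Aof n q (subst n q (P i) X) = (\<lambda>j. Aof n q X (tperm n i j))"
  "Bof n q (subst n q (P i) X) = Bof n q X" "Cof (subst n q (P i) X) = Cof X"
  using quasi_periodic_comp[OF quasi_periodic_Aof tperm_shift_equivariant, of 1 X i]
  by (auto intro!: Aof_eq simp: Bof_def Cof_def)

lemma state_Sig:
  "Aof n q (subst n q Sig X) = (\<lambda>j. Aof n q X (j - 1))"
  "Bof n q (subst n q Sig X) = Bof n q X" "Cof (subst n q Sig X) = Cof X"
  using quasi_periodic_comp[OF quasi_periodic_Aof shift_equivariant_comp_minus[OF shift_equivariant_id], of 1 X]
  by (auto intro!: Aof_eq simp: Bof_def Cof_def)

lemma state_P':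
  assumes "1 \<le> i" "i < n"
  shows "Aof n q (subst n q (P' i) X) = Aof n q X"
    "admissible X \<Longrightarrow> Bof n q (subst n q (P' i) X) = (\<lambda>j. Bof n q X (tperm n (int i) j))" "Cof (subst n q (P' i) X) = Cof X"
  using quasi_periodic_comp[OF quasi_periodic_Bof tperm_shift_equivariant, of 1 X i] assms tperm_in[of "int i" n 0]
  by (auto intro!: Bof_eq simp: Aof_def Cof_def admissible_def generic_def)

lemma tperm_n_0: "tperm n (int n) 0 = - 1"
  using tperm_in[of "int n" n 0] n1 by simp

lemma admissibleD:
  assumes "admissible X"
  shows "Bof n q X 0 = 1" "Bof n q X l \<noteq> 0" "Bof n q X (int n) = q * Bof n q X (- 1)"
    "Bof n q X (int n + 1) = q" "Cof X \<noteq> 0"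
  using genericD[OF assms[unfolded admissible_def]] by auto

lemma state_P'n:
  assumes "admissible X"
  shows "Aof n q (subst n q (P' n) X) = (\<lambda>j. q / Bof n q X (int n) * Aof n q X j)"
    "Bof n q (subst n q (P' n) X) = (\<lambda>j. q / Bof n q X (int n) * Bof n q X (tperm n (int n) j))"
    "Cof (subst n q (P' n) X) = Cof X"
  using quasi_periodic_comp[OF quasi_periodic_Bof tperm_shift_equivariant, of "q / Bof n q X (int n)" X "int n"]
    quasi_periodic_comp[OF quasi_periodic_Aof shift_equivariant_id, of "q / Bof n q X (int n)" X] admissibleD[OF assms] q0
  by (auto intro!: Bof_eq Aof_eq simp: Cof_def tperm_n_0)

lemma state_Pi1:
  assumes "admissible X"
  shows "Aof n q (subst n q Pi1 X) = (\<lambda>j. q / Bof n q X (int n) * Aof n q X (j - 1))"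
    "Bof n q (subst n q Pi1 X) = (\<lambda>j. q / Bof n q X (int n) * Bof n q X (j - 1))"
    "Cof (subst n q Pi1 X) = Cof X"
  using quasi_periodic_comp[OF quasi_periodic_Bof shift_equivariant_comp_minus[OF shift_equivariant_id], of "q / Bof n q X (int n)" X]
    quasi_periodic_comp[OF quasi_periodic_Aof shift_equivariant_comp_minus[OF shift_equivariant_id], of "q / Bof n q X (int n)" X] admissibleD[OF assms] q0
  by (auto intro!: Bof_eq Aof_eq simp: Cof_def)

lemma admissible_P: "admissible X \<Longrightarrow> admissible (subst n q (P i) X)"
  unfolding admissible_def state_P
  using generic_comp[OF _ tperm_shift_equivariant shift_equivariant_id, of _ _ _ 1] by (simp add: genericD(5) inj_def)

lemma admissible_Sig: "admissible X \<Longrightarrow> admissible (subst n q Sig X)"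
  unfolding admissible_def state_Sig
  using generic_comp[OF _ shift_equivariant_comp_minus[OF shift_equivariant_id] shift_equivariant_id, of _ _ _ 1] by (simp add: genericD(5) inj_def)

lemma admissible_P':
  assumes "1 \<le> i" "i < n" "admissible X"
  shows "admissible (subst n q (P' i) X)"
  using assms(3) generic_comp[OF _ shift_equivariant_id tperm_shift_equivariant tperm_inj[OF n1], of "Aof n q X" "Bof n q X" "Cof X" 1 "int i"]
    tperm_in[of "int i" n 0] assms admissibleD(1)[OF assms(3)]
  unfolding admissible_def state_P'(1)[OF assms(1,2)] state_P'(2)[OF assms] state_P'(3)[OF assms(1,2)] by simp

lemma admissible_P'n:
  assumes "admissible X"
  shows "admissible (subst n q (P' n) X)"
  unfolding admissible_def state_P'n[OF assms]
  by (rule generic_comp[OF assms[unfolded admissible_def] shift_equivariant_id tperm_shift_equivariant tperm_inj[OF n1]])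
     (use admissibleD[OF assms] q0 in \<open>simp add: tperm_n_0\<close>)

lemma admissible_Pi1:
  assumes "admissible X"
  shows "admissible (subst n q Pi1 X)"
  unfolding admissible_def state_Pi1[OF assms]
  by (rule generic_comp[OF assms[unfolded admissible_def] shift_equivariant_comp_minus[OF shift_equivariant_id] shift_equivariant_comp_minus[OF shift_equivariant_id]])
     (use admissibleD[OF assms] q0 in \<open>simp_all add: inj_def\<close>)

definition xcomp_par :: "par \<Rightarrow> nat \<Rightarrow> complex" where
  "xcomp_par X = xcomp n q (Aof n q X) (Bof n q X) (Cof X)"

lemma xfun_eq:
  assumes "admissible X" and m: "m \<le> n"
  shows "xfun n q X (n - m + 1) = xcomp_par X m"
proof -
  let ?A = "Aof n q X" and ?B = "Bof n q X" and ?c = "Cof X"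
  have g: "generic n q ?A ?B ?c" using assms by (simp add: admissible_def)
  have e: "n + 1 - (n - m + 1) = m" "n + 2 - (n - m + 1) = m + 1" using m by auto
  define RA where "RA k = (\<Prod>l\<in>{m+1..n+1}. qpoch (?A (int l)) q k)" for k
  define RB where "RB k = (\<Prod>l\<in>{m+1..n+1}. qpoch (?B (int l)) q k)" for k
  define S where "S = (\<Prod>l\<in>{m+1..n}. 1 - ?B (int l))"
  have RA: "qpoch_prod q ?A (n + 1) k = qpoch_prod q ?A m k * RA k" for k
    unfolding qpoch_prod_def RA_def using m by (intro prod_split) simp
  have RB: "qpoch_prod q ?B (n + 1) k = qpoch_prod q ?B m k * RB k" for k
    unfolding qpoch_prod_def RB_def using m by (intro prod_split) simp
  have S: "lin_prod ?B n 1 = lin_prod ?B m 1 * S"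
    unfolding lin_prod_def S_def mult_1_left using m by (intro prod_split) simp
  have nA: "lin_prod ?A m 1 \<noteq> 0" using lin_prod_A_nonzero[OF g, of m 0] by simp
  have nB: "lin_prod ?B m 1 \<noteq> 0" by (rule lin_prod_B_nonzero'[OF g])
  have pw: "q ^ k * ?c ^ k *
        (\<Prod>l\<in>{1..m}. qpoch (q * ?A (int l)) q k / qpoch (q * ?B (int l)) q k) *
        (\<Prod>l\<in>{m+1..n+1}. qpoch (?A (int l)) q k / qpoch (?B (int l)) q k) =
     weight n q ?A ?B ?c k * (lin_prod ?B m 1 / lin_prod ?A m 1 * (lin_prod ?A m (q ^ k) / lin_prod ?B m (q ^ k)))" for k
  proof -
    have a: "(\<Prod>l\<in>{1..m}. qpoch (q * ?A (int l)) q k) = qpoch_prod q ?A m k * lin_prod ?A m (q ^ k) / lin_prod ?A m 1"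
      using qpoch_prod_scale[of ?A m q k] nA by (simp add: qpoch_prod_def field_simps)
    have b: "(\<Prod>l\<in>{1..m}. qpoch (q * ?B (int l)) q k) = qpoch_prod q ?B m k * lin_prod ?B m (q ^ k) / lin_prod ?B m 1"
      using qpoch_prod_scale[of ?B m q k] nB by (simp add: qpoch_prod_def field_simps)
    show ?thesis
      unfolding prod_dividef a b RA_def[symmetric] RB_def[symmetric] weight_def RA RB
      by (simp add: power_mult_distrib mult_ac)
  qed
  have "xfun n q X (n - m + 1) = lin_prod ?A m 1 * S *
      weighted_sum n q ?A ?B ?c (\<lambda>z. lin_prod ?B m 1 / lin_prod ?A m 1 * (lin_prod ?A m z / lin_prod ?B m z))"
    unfolding xfun_def Let_def e pw weighted_sum_def lin_prod_def S_def by simp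
  also have "\<dots> = lin_prod ?A m 1 * S * (lin_prod ?B m 1 / lin_prod ?A m 1 * weighted_sum n q ?A ?B ?c (\<lambda>z. lin_prod ?A m z / lin_prod ?B m z))"
    by (subst weighted_sum_scale[OF g converges_along_quotient]) simp
  finally show ?thesis using nA by (simp add: xcomp_par_def xcomp_def S)
qed

lemma xvec_eq: "admissible X \<Longrightarrow> xvec n q X = rev_vec n (xcomp_par X)"
  unfolding xvec_def rev_vec_def
  by (rule eq_vecI) (auto simp flip: xfun_eq)

text \<open>The letters for which M_w x = w(x) holds on its own.  The letters p'_n and pi_1 pass to
  a different solution of the underlying q-difference equation, and only certain products of
  them act on x.\<close>

fun exact :: "letter \<Rightarrow> bool" where
  "exact (P i) \<longleftrightarrow> True" | "exact (P' i) \<longleftrightarrow> 1 \<le> i \<and> i < n" | "exact Sig \<longleftrightarrow> True" | "exact Pi1 \<longleftrightarrow> False"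

lemma admissible_exact: "exact w \<Longrightarrow> admissible X \<Longrightarrow> admissible (subst n q w X)"
  by (cases w) (auto simp del: subst.simps intro: admissible_P admissible_P' admissible_Sig)

lemma admissible_exact_word: "(\<And>w. w \<in> set ws \<Longrightarrow> exact w) \<Longrightarrow> admissible X \<Longrightarrow> admissible (act n q ws X)"
proof (induction ws arbitrary: X)
  case (Cons w ws)
  then show ?case using Cons.IH[OF _ admissible_exact[of w X]] by simp
qed simp

lemma xvec_exact:
  assumes "exact w" "admissible X"
  shows "xvec n q (subst n q w X) = Mlet n q lc lq lg w X *\<^sub>v xvec n q X"
proof -
  let ?A = "Aof n q X" and ?B = "Bof n q X" and ?c = "Cof X"
  have g: "generic n q ?A ?B ?c" using assms by (simp add: admissible_def)
  have "xvec n q (subst n q w X) = rev_vec n (xcomp_par (subst n q w X))"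
    by (intro xvec_eq admissible_exact assms)
  also have "\<dots> = Mlet n q lc lq lg w X *\<^sub>v rev_vec n (xcomp_par X)"
  proof (cases w)
    case (P i0)
    let ?i = "i0 mod (int n + 1)"
    have t: "tperm n i0 = tperm n ?i" by (simp add: tperm_mod)
    show ?thesis
    proof (cases "?i = 0")
      case True
      show ?thesis unfolding P Mlet_P0_rev_vec[OF True] xcomp_par_def state_P t unfolding True
        by (rule rev_vec_cong) (simp add: xcomp_tperm_0[OF g])
    next
      case False
      obtain i where i: "?i = int i" using nonneg_eq_int[of ?i] by (auto simp: pos_mod_sign)
      have "?i < int n + 1" by (rule pos_mod_bound) simp
      then have i': "1 \<le> i" "i \<le> n" using False i by linarith+
      show ?thesis unfolding P Mlet_P_rev_vec[OF i' i] xcomp_par_def state_P t unfolding i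
        by (rule rev_vec_cong) (simp add: xcomp_tperm_a[OF g i'])
    qed
  next
    case (P' i)
    then have i: "1 \<le> i" "i < n" using assms by auto
    show ?thesis unfolding P' Mlet_P'_rev_vec[OF i] xcomp_par_def state_P'(1,3)[OF i] state_P'(2)[OF i assms(2)]
      by (rule rev_vec_cong) (simp add: xcomp_tperm_b[OF g i])
  next
    case Sig
    have "?A 0 \<noteq> ?B 0" by (rule genericD(8)[OF g])
    show ?thesis unfolding Sig Mlet_Sig_rev_vec[OF \<open>?A 0 \<noteq> ?B 0\<close>] xcomp_par_def state_Sig
      by (rule rev_vec_cong) (simp add: xcomp_sigma[OF g] genericD(5)[OF g])
  qed (use assms in simp)
  finally show ?thesis using assms(2) by (simp add: xvec_eq)
qed

lemma xvec_carrier: "xvec n q X \<in> carrier_vec (n + 1)"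
  by (simp add: xvec_def)

lemma xvec_append:
  assumes "xvec n q (act n q u X) = s \<cdot>\<^sub>v (wmat n q lc lq lg u X *\<^sub>v xvec n q X)"
    and "xvec n q (act n q v (act n q u X)) = t \<cdot>\<^sub>v (wmat n q lc lq lg v (act n q u X) *\<^sub>v xvec n q (act n q u X))"
  shows "xvec n q (act n q (u @ v) X) = (s * t) \<cdot>\<^sub>v (wmat n q lc lq lg (u @ v) X *\<^sub>v xvec n q X)"
proof -
  have c: "wmat n q lc lq lg u X *\<^sub>v xvec n q X \<in> carrier_vec (n + 1)"
    by (rule mult_mat_vec_carrier[OF wmat_carrier xvec_carrier])
  show ?thesis
    unfolding act_append assms(2) unfolding assms(1) wmat_append
    unfolding mult_mat_vec[OF wmat_carrier c] assoc_mult_mat_vec[OF wmat_carrier wmat_carrier xvec_carrier]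
    by (simp add: smult_smult_assoc mult.commute)
qed

lemma xvec_exact_word:
  assumes "\<And>w. w \<in> set ws \<Longrightarrow> exact w" "admissible X"
  shows "xvec n q (act n q ws X) = 1 \<cdot>\<^sub>v (wmat n q lc lq lg ws X *\<^sub>v xvec n q X)"
  using assms
proof (induction ws arbitrary: X)
  case Nil
  then show ?case using one_mult_mat_vec[OF xvec_carrier] by simp
next
  case (Cons w ws)
  have w: "xvec n q (act n q [w] X) = 1 \<cdot>\<^sub>v (wmat n q lc lq lg [w] X *\<^sub>v xvec n q X)"
    using xvec_exact[of w X lc lq lg] Cons.prems left_mult_one_mat[OF Mlet_carrier, of n q lc lq lg w X]
    by (simp del: subst.simps Mlet.simps)
  have "admissible (act n q [w] X)" using admissible_exact[of w X] Cons.prems by (simp del: subst.simps)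
  from xvec_append[OF w Cons.IH[OF _ this]] Cons.prems show ?case
    by (simp del: subst.simps Mlet.simps wmat.simps)
qed

end

lemma quasi_periodic_minus:
  assumes "quasi_periodic n q g" "q \<noteq> 0"
  shows "g (j - (int n + 1)) = inverse q * g j"
proof -
  have "g (j - (int n + 1) + int (n + 1)) = q * g (j - (int n + 1))"
    using assms(1) unfolding quasi_periodic_def by blast
  then show ?thesis using assms(2) by (simp add: add.commute)
qed

lemma frac_cancel:
  fixes l x y :: "'a :: field"
  assumes "l \<noteq> 0"
  shows "(l - l * x) / (l * y - l * x) = (1 - x) / (y - x)" "(l * y - l) / (l * y - l * x) = (y - 1) / (y - x)"
proof -
  have "l - l * x = l * (1 - x)" "l * y - l * x = l * (y - x)" "l * y - l = l * (y - 1)"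
    by (simp_all add: right_diff_distrib)
  then show "(l - l * x) / (l * y - l * x) = (1 - x) / (y - x)" "(l * y - l) / (l * y - l * x) = (y - 1) / (y - x)"
    using assms by simp_all
qed

lemma cyc_value:
  assumes "0 \<le> s" "s \<le> int n" "(j - i) mod int (n + 1) = s"
  shows "cyc n i r j = (if s < int r then j + 1 else if s = int r then j - int r else j)"
  unfolding cyc_def Let_def assms(3) ..

lemma mod_range:
  fixes x :: int
  assumes "0 \<le> x" "x \<le> int n"
  shows "x mod int (n + 1) = x" "(x - int (n + 1)) mod int (n + 1) = x"
proof -
  show 1: "x mod int (n + 1) = x" using assms by (intro mod_pos_pos_trivial) auto
  have "(x - int (n + 1)) mod int (n + 1) = x mod int (n + 1)"
    using mod_add_self2[of "x - int (n + 1)" "int (n + 1)"] by (simp only: diff_add_cancel)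
  then show "(x - int (n + 1)) mod int (n + 1) = x" unfolding 1 .
qed

lemma cyc_shift_a:
  assumes "1 \<le> i" "i \<le> n + 1" "1 \<le> k" "k \<le> n + 1"
  shows "cyc n (int i) n (int k - 1) = (if i = k then int k - (int n + 1) else int k)"
proof (cases "k \<le> i")
  case True
  have e: "int k - 1 - int i = (int n + int k - int i) - int (n + 1)" by simp
  have "(int k - 1 - int i) mod int (n + 1) = int n + int k - int i"
    unfolding e by (rule mod_range) (use True assms in auto)
  then show ?thesis using True assms by (subst cyc_value) auto
next
  case False
  then have "(int k - 1 - int i) mod int (n + 1) = int k - 1 - int i"
    using mod_range(1)[of "int k - 1 - int i" n] assms by simp
  then show ?thesis using False assms by (subst cyc_value) auto
qed

lemma cyc_shift_b:
  assumes "1 \<le> j" "j \<le> n" "1 \<le> l" "l \<le> n"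
  shows "cyc n (int j) (n - j) (tperm n (int n) (cyc n 1 (j - 1) (int l) - 1)) =
    (if j = l then int l - (int n + 1) else int l)"
proof -
  have m: "(int l - 1) mod int (n + 1) = int l - 1"
    using mod_range(1)[of "int l - 1" n] assms by simp
  have c1: "cyc n 1 (j - 1) (int l) = (if l < j then int l + 1 else if l = j then 1 else int l)"
    using assms by (subst cyc_value[OF _ _ m]) auto
  consider "l < j" | "l = j" | "j < l" by linarith
  then show ?thesis
  proof cases
    case 1
    have "tperm n (int n) (int l) = int l" using tperm_in[of "int n" n "int l"] 1 assms by simp
    moreover have "(int l - int j) mod int (n + 1) = int l - int j + int (n + 1)"
      using mod_range(2)[of "int l - int j + int (n + 1)" n] 1 assms by simp
    ultimately show ?thesis using 1 assms unfolding c1 by (subst cyc_value) auto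
  next
    case 2
    have "tperm n (int n) 0 = - 1" using tperm_in[of "int n" n 0] assms by simp
    moreover have e: "- 1 - int j = int (n - j) - int (n + 1)" using 2 assms by (simp add: of_nat_diff)
    have "(- 1 - int j) mod int (n + 1) = int (n - j)"
      unfolding e by (rule mod_range) auto
    ultimately show ?thesis using 2 assms unfolding c1 by (subst cyc_value) (auto simp: of_nat_diff)
  next
    case 3
    have "tperm n (int n) (int l - 1) = int l - 1" using tperm_in[of "int n" n "int l - 1"] 3 assms by simp
    moreover have "(int l - 1 - int j) mod int (n + 1) = int l - 1 - int j"
      using mod_range(1)[of "int l - 1 - int j" n] 3 assms by simp
    ultimately show ?thesis using 3 assms unfolding c1 by (subst cyc_value) (auto simp: of_nat_diff)
  qed
qed

lemma cyc_one:
  assumes "r \<le> n"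
  shows "l = int r + 1 \<Longrightarrow> cyc n 1 r l = 1" "int r + 1 < l \<Longrightarrow> l \<le> int n + 1 \<Longrightarrow> cyc n 1 r l = l"
    "1 \<le> l \<Longrightarrow> l \<le> int r \<Longrightarrow> cyc n 1 r l = l + 1"
proof -
  have m: "(l - 1) mod int (n + 1) = l - 1" if "1 \<le> l" "l \<le> int n + 1"
    using mod_range(1)[of "l - 1" n] that by simp
  show "l = int r + 1 \<Longrightarrow> cyc n 1 r l = 1" "int r + 1 < l \<Longrightarrow> l \<le> int n + 1 \<Longrightarrow> cyc n 1 r l = l"
    "1 \<le> l \<Longrightarrow> l \<le> int r \<Longrightarrow> cyc n 1 r l = l + 1"
    using assms by (subst cyc_value[OF _ _ m]; simp)+
qed

lemma cyc_last:
  assumes "j \<le> n"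
  shows "cyc n (int j) (n - j) (int n) = int j"
proof -
  have "(int n - int j) mod int (n + 1) = int n - int j"
    using mod_range(1)[of "int n - int j" n] assms by simp
  then show ?thesis using assms by (subst cyc_value) (auto simp: of_nat_diff)
qed

context qhyp
begin

lemma act_pword:
  fixes X :: par and i r :: nat
  assumes "r \<le> n"
  defines "Y \<equiv> act n q (map (\<lambda>k. P (int i + int k)) [0..<r]) X"
  shows "Aof n q Y = (\<lambda>j. Aof n q X (cyc n (int i) r j))" "Bof n q Y = Bof n q X" "Cof Y = Cof X"
proof -
  let ?Y = "\<lambda>r. act n q (map (\<lambda>k. P (int i + int k)) [0..<r]) X"
  have "Aof n q (?Y r) = (\<lambda>j. Aof n q X (cyc n (int i) r j)) \<and> Bof n q (?Y r) = Bof n q X \<and> Cof (?Y r) = Cof X"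
    using assms(1)
  proof (induction r)
    case (Suc r)
    have "?Y (Suc r) = subst n q (P (int i + int r)) (?Y r)"
      by (simp add: act_append del: subst.simps)
    moreover have "cyc n (int i) r (tperm n (int i + int r) j) = cyc n (int i) (Suc r) j" for j
      by (rule cyc_Suc) (use Suc.prems in simp)
    ultimately show ?case
      using Suc by (simp add: state_P del: subst.simps)
  qed simp
  then show "Aof n q Y = (\<lambda>j. Aof n q X (cyc n (int i) r j))" "Bof n q Y = Bof n q X" "Cof Y = Cof X"
    by (simp_all add: Y_def)
qed

lemma act_P'word:
  fixes X :: par and j r :: nat
  assumes "1 \<le> j" "j + r \<le> n" "admissible X"
  defines "Y \<equiv> act n q (map P' [j..<j + r]) X"
  shows "Aof n q Y = Aof n q X" "Bof n q Y = (\<lambda>l. Bof n q X (cyc n (int j) r l))" "Cof Y = Cof X" "admissible Y"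
proof -
  let ?Y = "\<lambda>r. act n q (map P' [j..<j + r]) X"
  have "Aof n q (?Y r) = Aof n q X \<and> Bof n q (?Y r) = (\<lambda>l. Bof n q X (cyc n (int j) r l)) \<and> Cof (?Y r) = Cof X \<and> admissible (?Y r)"
    using assms(2)
  proof (induction r)
    case (Suc r)
    then have IH: "Aof n q (?Y r) = Aof n q X" "Bof n q (?Y r) = (\<lambda>l. Bof n q X (cyc n (int j) r l))"
      "Cof (?Y r) = Cof X" "admissible (?Y r)" by simp_all
    have i: "1 \<le> j + r" "j + r < n" using Suc.prems assms(1) by auto
    have e: "?Y (Suc r) = subst n q (P' (j + r)) (?Y r)"
      by (simp add: act_append del: subst.simps)
    have "cyc n (int j) r (tperm n (int (j + r)) l) = cyc n (int j) (Suc r) l" for l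
      using cyc_Suc[of r n "int j" l] Suc.prems by simp
    then show ?case
      unfolding e state_P'(1,3)[OF i] state_P'(2)[OF i IH(4)] IH(1-3) using admissible_P'[OF i IH(4)] by simp
  qed (use assms in simp)
  then show "Aof n q Y = Aof n q X" "Bof n q Y = (\<lambda>l. Bof n q X (cyc n (int j) r l))" "Cof Y = Cof X" "admissible Y"
    by (simp_all add: Y_def)
qed

lemma block_swap:
  assumes admissible: "admissible X"
  defines "A \<equiv> Aof n q X" and "B \<equiv> Bof n q X"
  defines "W \<equiv> act n q [P' n, Pi1] X"
  shows "Aof n q W = (\<lambda>j. A (j - 1))" "Bof n q W = (\<lambda>l. B (tperm n (int n) (l - 1)))" "Cof W = Cof X" "admissible W"
    "cpw lc lq lg (inverse q * B (int n)) * cpw lc lq lg (q / B (int n)) = 1 \<Longrightarrow>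
     xvec n q W = ((1 - A 0) / (1 - B (int n))) \<cdot>\<^sub>v (wmat n q lc lq lg [P' n, Pi1] X *\<^sub>v xvec n q X)"
proof -
  let ?X1 = "subst n q (P' n) X"
  have W: "W = subst n q Pi1 ?X1" by (simp add: W_def del: subst.simps)
  have ok1: "admissible ?X1" by (rule admissible_P'n[OF admissible])
  have B0: "B l \<noteq> 0" for l using admissibleD(2)[OF admissible] by (simp add: B_def)
  have b1: "Bof n q ?X1 (int n) = q * q / B (int n)"
    using tperm_in[of "int n" n "int n"] n1 admissibleD(4)[OF admissible] unfolding state_P'n[OF admissible] B_def by simp
  show A: "Aof n q W = (\<lambda>j. A (j - 1))" and B: "Bof n q W = (\<lambda>l. B (tperm n (int n) (l - 1)))" and C: "Cof W = Cof X"
    unfolding W state_Pi1[OF ok1] unfolding b1 unfolding state_P'n[OF admissible]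
    using q0 B0[of "int n"] by (simp_all add: A_def B_def)
  show okW: "admissible W" unfolding W by (rule admissible_Pi1[OF ok1])
  assume k: "cpw lc lq lg (inverse q * B (int n)) * cpw lc lq lg (q / B (int n)) = 1"
  let ?k1 = "cpw lc lq lg (inverse q * B (int n))" and ?k2 = "cpw lc lq lg (q / B (int n))"
  have k2: "cpw lc lq lg (inverse q * Bof n q ?X1 (int n)) = ?k2"
    unfolding b1 using q0 by (simp add: mult.assoc[symmetric])
  have w: "wmat n q lc lq lg [P' n, Pi1] X = Mlet n q lc lq lg Pi1 ?X1 * Mlet n q lc lq lg (P' n) X"
    using left_mult_one_mat[OF Mlet_carrier, of n q lc lq lg Pi1 ?X1]
    by (simp del: subst.simps Mlet.simps)
  have "wmat n q lc lq lg [P' n, Pi1] X *\<^sub>v xvec n q X =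
      Mlet n q lc lq lg Pi1 ?X1 *\<^sub>v (Mlet n q lc lq lg (P' n) X *\<^sub>v xvec n q X)"
    unfolding w by (rule assoc_mult_mat_vec[OF Mlet_carrier Mlet_carrier xvec_carrier])
  also have "\<dots> = rev_vec n (\<lambda>m. ?k2 * (if m = 0 then q * Cof X * (?k1 *
        ((B (int n) - A (int n + 1)) / (B (int n + 1) - A (int n + 1)) * xcomp_par X n
         + (B (int n + 1) - B (int n)) / (B (int n + 1) - A (int n + 1)) * inverse q * inverse (Cof X) * xcomp_par X 0))
      else ?k1 * xcomp_par X (m - 1)))"
    unfolding xvec_eq[OF admissible] Mlet_P'n_rev_vec[OF n1] Mlet_Pi1_rev_vec k2 state_P'n(3)[OF admissible] A_def[symmetric] B_def[symmetric]
    by (rule rev_vec_cong) auto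
  also have "\<dots> = rev_vec n (\<lambda>m. if m = 0 then
        (B (int n) - A (int n + 1)) / (B (int n + 1) - A (int n + 1)) * (q * Cof X * xcomp_par X n)
         + (B (int n + 1) - B (int n)) / (B (int n + 1) - A (int n + 1)) * xcomp_par X 0
      else xcomp_par X (m - 1))"
  proof (rule rev_vec_cong)
    fix m
    have "?k2 * (?k1 * x) = (?k1 * ?k2) * x" for x by (simp only: mult_ac)
    then have 1: "?k2 * (?k1 * x) = x" for x unfolding k by simp
    have 2: "?k2 * (q * Cof X * (?k1 * (\<alpha> * x + \<beta> * inverse q * inverse (Cof X) * y))) = \<alpha> * (q * Cof X * x) + \<beta> * y" for x y \<alpha> \<beta>
    proof -
      have "?k2 * (q * Cof X * (?k1 * (\<alpha> * x + \<beta> * inverse q * inverse (Cof X) * y))) =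
         ?k2 * (?k1 * (q * Cof X * (\<alpha> * x + \<beta> * inverse q * inverse (Cof X) * y)))" by (simp add: mult_ac)
      also have "\<dots> = \<alpha> * (q * Cof X * x) + \<beta> * y"
        unfolding 1 using q0 admissibleD(5)[OF admissible] by (simp add: field_simps)
      finally show ?thesis .
    qed
    show "?k2 * (if m = 0 then q * Cof X * (?k1 *
        ((B (int n) - A (int n + 1)) / (B (int n + 1) - A (int n + 1)) * xcomp_par X n
         + (B (int n + 1) - B (int n)) / (B (int n + 1) - A (int n + 1)) * inverse q * inverse (Cof X) * xcomp_par X 0))
      else ?k1 * xcomp_par X (m - 1)) = (if m = 0 then
        (B (int n) - A (int n + 1)) / (B (int n + 1) - A (int n + 1)) * (q * Cof X * xcomp_par X n)
         + (B (int n + 1) - B (int n)) / (B (int n + 1) - A (int n + 1)) * xcomp_par X 0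
      else xcomp_par X (m - 1))"
      by (cases "m = 0") (simp_all only: refl if_True if_False 1 2)
  qed
  finally have M: "wmat n q lc lq lg [P' n, Pi1] X *\<^sub>v xvec n q X = \<dots>" .
  show "xvec n q W = ((1 - A 0) / (1 - B (int n))) \<cdot>\<^sub>v (wmat n q lc lq lg [P' n, Pi1] X *\<^sub>v xvec n q X)"
    unfolding M smult_rev_vec xvec_eq[OF okW] xcomp_par_def A B C
    by (rule rev_vec_cong) (use xcomp_shift_both[OF admissible[unfolded admissible_def]] in \<open>simp add: A_def B_def\<close>)
qed

lemma block_shift_partial:
  assumes admissible: "admissible X" and i: "i < n"
  defines "A \<equiv> Aof n q X" and "B \<equiv> Bof n q X" and "u \<equiv> Pi1 # map P' [1..<Suc i]"
  shows "wmat n q lc lq lg u X *\<^sub>v xvec n q X = rev_vec n (\<lambda>m. cpw lc lq lg (inverse q * B (int n)) *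
      (if m = 0 then q * Cof X * xcomp_par X n else if m \<le> i then xcomp_shift A B (Cof X) m else xcomp_par X (m - 1)))"
    "Aof n q (act n q u X) = (\<lambda>j. q / B (int n) * A (j - 1))"
    "Bof n q (act n q u X) = (\<lambda>j. q / B (int n) * B (cyc n 1 i j - 1))"
    "Cof (act n q u X) = Cof X" "admissible (act n q u X)"
proof -
  note g = admissible[unfolded admissible_def]
  have B0: "B l \<noteq> 0" for l using admissibleD(2)[OF admissible] by (simp add: B_def)
  let ?X1 = "subst n q Pi1 X" and ?l = "q / B (int n)" and ?k = "cpw lc lq lg (inverse q * B (int n))"
  have ok1: "admissible ?X1" by (rule admissible_Pi1[OF admissible])
  have act_u: "act n q (Pi1 # map P' [1..<Suc i]) X = act n q (map P' [1..<1 + i]) ?X1" for i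
    by (simp del: subst.simps)
  have st: "Aof n q (act n q (Pi1 # map P' [1..<Suc i]) X) = (\<lambda>j. ?l * A (j - 1))"
    "Bof n q (act n q (Pi1 # map P' [1..<Suc i]) X) = (\<lambda>j. ?l * B (cyc n 1 i j - 1))"
    "Cof (act n q (Pi1 # map P' [1..<Suc i]) X) = Cof X" "admissible (act n q (Pi1 # map P' [1..<Suc i]) X)" if "i < n" for i
    using act_P'word[OF _ _ ok1, of 1 i] that
    unfolding act_u state_Pi1[OF admissible] A_def B_def by simp_all
  show "Aof n q (act n q u X) = (\<lambda>j. ?l * A (j - 1))" "Bof n q (act n q u X) = (\<lambda>j. ?l * B (cyc n 1 i j - 1))"
    "Cof (act n q u X) = Cof X" "admissible (act n q u X)"
    using st[OF i] by (simp_all only: u_def)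
  show "wmat n q lc lq lg u X *\<^sub>v xvec n q X = rev_vec n (\<lambda>m. ?k *
      (if m = 0 then q * Cof X * xcomp_par X n else if m \<le> i then xcomp_shift A B (Cof X) m else xcomp_par X (m - 1)))"
    using i unfolding u_def
  proof (induction i)
    case 0
    have "wmat n q lc lq lg [Pi1] X = Mlet n q lc lq lg Pi1 X"
      using left_mult_one_mat[OF Mlet_carrier, of n q lc lq lg Pi1 X] by (simp del: Mlet.simps)
    then show ?case
      unfolding xvec_eq[OF admissible] by (simp add: Mlet_Pi1_rev_vec B_def del: Mlet.simps wmat.simps) (rule rev_vec_cong, simp)
  next
    case (Suc i)
    then have i: "1 \<le> Suc i" "Suc i < n" "i < n" by auto
    let ?u = "Pi1 # map P' [1..<Suc i]"
    let ?Z = "act n q ?u X"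
    have u: "Pi1 # map P' [1..<Suc (Suc i)] = ?u @ [P' (Suc i)]" by simp
    have "wmat n q lc lq lg [P' (Suc i)] ?Z = Mlet n q lc lq lg (P' (Suc i)) ?Z"
      using left_mult_one_mat[OF Mlet_carrier, of n q lc lq lg "P' (Suc i)" ?Z] by (simp del: Mlet.simps act.simps)
    then have "wmat n q lc lq lg (Pi1 # map P' [1..<Suc (Suc i)]) X *\<^sub>v xvec n q X =
      Mlet n q lc lq lg (P' (Suc i)) ?Z *\<^sub>v (wmat n q lc lq lg ?u X *\<^sub>v xvec n q X)"
      unfolding u wmat_append using assoc_mult_mat_vec[OF Mlet_carrier wmat_carrier xvec_carrier] by metis
    also note Suc.IH[OF i(3)]
    also note Mlet_P'_rev_vec[OF i(1,2)]
    also note M = calculation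
    have c: "cyc n 1 i (int (Suc i)) = 1" "cyc n 1 i (int (Suc i) + 1) = int (Suc i) + 1"
      using i by (simp_all add: cyc_one)
    have b: "Bof n q ?Z (int (Suc i)) = ?l" "Bof n q ?Z (int (Suc i) + 1) = ?l * B (int (Suc i))"
      unfolding st(2)[OF i(3)] c using admissibleD(1)[OF admissible] by (simp_all add: B_def)
    have a: "Aof n q ?Z (int (Suc i) + 1) = ?l * A (int (Suc i))"
      unfolding st(1)[OF i(3)] by simp
    have l: "?l \<noteq> 0" using q0 B0 by simp
    note f = frac_cancel[OF l]
    show ?case
      unfolding M a b f
    proof (rule rev_vec_cong)
      fix m
      have h: "xcomp_shift A B (Cof X) (Suc i) = (1 - A (int (Suc i))) / (B (int (Suc i)) - A (int (Suc i))) * xcomp_par X i +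
        (B (int (Suc i)) - 1) / (B (int (Suc i)) - A (int (Suc i))) * xcomp_par X (Suc i)"
        using xcomp_shift_pos[OF g, of "Suc i"] by (simp add: A_def B_def xcomp_par_def)
      show "(if m = Suc i then (1 - A (int (Suc i))) / (B (int (Suc i)) - A (int (Suc i))) *
            (?k * (if Suc i = 0 then q * Cof X * xcomp_par X n else if Suc i \<le> i then xcomp_shift A B (Cof X) (Suc i) else xcomp_par X (Suc i - 1))) +
            (B (int (Suc i)) - 1) / (B (int (Suc i)) - A (int (Suc i))) *
            (?k * (if Suc i + 1 = 0 then q * Cof X * xcomp_par X n else if Suc i + 1 \<le> i then xcomp_shift A B (Cof X) (Suc i + 1) else xcomp_par X (Suc i + 1 - 1)))
          else ?k * (if m = 0 then q * Cof X * xcomp_par X n else if m \<le> i then xcomp_shift A B (Cof X) m else xcomp_par X (m - 1))) =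
        ?k * (if m = 0 then q * Cof X * xcomp_par X n else if m \<le> Suc i then xcomp_shift A B (Cof X) m else xcomp_par X (m - 1))"
        by (auto simp: h distrib_left mult.left_commute le_Suc_eq)
    qed
  qed
qed

lemma block_shift:
  assumes admissible: "admissible X"
  defines "A \<equiv> Aof n q X" and "B \<equiv> Bof n q X" and "u \<equiv> Pi1 # map P' [1..<n + 1]"
  defines "W \<equiv> act n q u X"
  shows "Aof n q W = (\<lambda>j. q * A (j - 1))" "\<And>l. 1 \<le> l \<Longrightarrow> l \<le> int n \<Longrightarrow> Bof n q W l = q * B l" "Cof W = Cof X" "admissible W"
    "cpw lc lq lg (inverse q * B (int n)) * cpw lc lq lg (1 / B (int n)) = inverse (Cof X) \<Longrightarrow>
     xvec n q W = inverse (q * (\<Prod>l\<in>{1..n}. (1 - A (int l)) / (1 - q * B (int l)))) \<cdot>\<^sub>v (wmat n q lc lq lg u X *\<^sub>v xvec n q X)"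
proof -
  note g = admissible[unfolded admissible_def]
  have B0: "B l \<noteq> 0" for l using admissibleD(2)[OF admissible] by (simp add: B_def)
  have n': "n - 1 < n" "Suc (n - 1) = n" using n1 by auto
  let ?u = "Pi1 # map P' [1..<Suc (n - 1)]"
  let ?Z = "act n q ?u X" and ?l = "q / B (int n)"
  let ?k1 = "cpw lc lq lg (inverse q * B (int n))" and ?k2 = "cpw lc lq lg (1 / B (int n))"
  note part = block_shift_partial[OF admissible n'(1), folded A_def B_def]
  have u: "u = ?u @ [P' n]" using n1 by (simp add: u_def n'(2))
  have W: "W = subst n q (P' n) ?Z" unfolding W_def u act_append by (simp del: subst.simps)
  have okZ: "admissible ?Z" by (rule part(5))
  have c: "cyc n 1 (n - 1) (int n) = 1" "cyc n 1 (n - 1) (int n + 1) = int n + 1"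
    using n1 by (simp_all add: cyc_one of_nat_diff)
  have bn: "Bof n q ?Z (int n) = ?l" "Bof n q ?Z (int n + 1) = ?l * B (int n)"
    unfolding part(3) c using admissibleD(1)[OF admissible] by (simp_all add: B_def)
  have an: "Aof n q ?Z (int n + 1) = ?l * A (int n)" unfolding part(2) by simp
  have l: "?l \<noteq> 0" "q / ?l = B (int n)" using q0 B0 by simp_all
  show A: "Aof n q W = (\<lambda>j. q * A (j - 1))"
    unfolding W state_P'n[OF okZ] unfolding bn unfolding part(2) l using q0 B0 by simp
  have cyc: "cyc n 1 (n - 1) (tperm n (int n) j) = cyc n 1 n j" for j
    using cyc_Suc[of "n - 1" n 1 j] n1 by (simp add: of_nat_diff)
  show B: "Bof n q W l = q * B l" if "1 \<le> l" "l \<le> int n" for l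
    unfolding W state_P'n[OF okZ] unfolding bn unfolding part(3) cyc l
    using q0 B0 cyc_one(3)[OF order_refl that] by simp
  show C: "Cof W = Cof X" unfolding W state_P'n[OF okZ] part(4) ..
  show okW: "admissible W" unfolding W by (rule admissible_P'n[OF okZ])
  assume k: "?k1 * ?k2 = inverse (Cof X)"
  have k2: "cpw lc lq lg (inverse q * Bof n q ?Z (int n)) = ?k2" unfolding bn using q0 by (simp add: inverse_eq_divide)
  note f = frac_cancel[OF l(1)]
  have "wmat n q lc lq lg [P' n] ?Z = Mlet n q lc lq lg (P' n) ?Z"
    using left_mult_one_mat[OF Mlet_carrier, of n q lc lq lg "P' n" ?Z] by (simp del: Mlet.simps act.simps)
  then have "wmat n q lc lq lg u X *\<^sub>v xvec n q X =
    Mlet n q lc lq lg (P' n) ?Z *\<^sub>v (wmat n q lc lq lg ?u X *\<^sub>v xvec n q X)"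
    unfolding u wmat_append using assoc_mult_mat_vec[OF Mlet_carrier wmat_carrier xvec_carrier] by metis
  also note part(1)
  also note Mlet_P'n_rev_vec[OF n1]
  also note M1 = calculation
  have M: "wmat n q lc lq lg u X *\<^sub>v xvec n q X = rev_vec n (\<lambda>m. inverse (Cof X) * xcomp_shift A B (Cof X) m)"
    unfolding M1 k2 unfolding bn an f part(4)
  proof (rule rev_vec_cong)
    fix m assume m: "m \<le> n"
    have h: "xcomp_shift A B (Cof X) n = (1 - A (int n)) / (B (int n) - A (int n)) * xcomp_par X (n - 1) +
        (B (int n) - 1) / (B (int n) - A (int n)) * xcomp_par X n"
      using xcomp_shift_pos[OF g, of n] n1 by (simp add: A_def B_def xcomp_par_def)
    have h0: "xcomp_shift A B (Cof X) 0 = q * Cof X * xcomp_par X n"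
      using xcomp_shift_0[OF g] by (simp add: A_def B_def xcomp_par_def)
    have 1: "\<alpha> * (?k1 * x) + \<beta> * inverse q * inverse (Cof X) * (?k1 * (q * Cof X * y)) = ?k1 * (\<alpha> * x + \<beta> * y)" for x y \<alpha> \<beta>
      using q0 admissibleD(5)[OF admissible] by (simp add: field_simps)
    have 2: "?k2 * (?k1 * x) = inverse (Cof X) * x" for x
      unfolding k[symmetric] by (simp add: mult_ac)
    show "?k2 * (if m = n then (1 - A (int n)) / (B (int n) - A (int n)) *
          (?k1 * (if n = 0 then q * Cof X * xcomp_par X n else if n \<le> n - 1 then xcomp_shift A B (Cof X) n else xcomp_par X (n - 1)))
        + (B (int n) - 1) / (B (int n) - A (int n)) * inverse q * inverse (Cof X) *
          (?k1 * (if 0 = (0::nat) then q * Cof X * xcomp_par X n else if 0 \<le> n - 1 then xcomp_shift A B (Cof X) 0 else xcomp_par X (0 - 1)))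
      else ?k1 * (if m = 0 then q * Cof X * xcomp_par X n else if m \<le> n - 1 then xcomp_shift A B (Cof X) m else xcomp_par X (m - 1))) =
      inverse (Cof X) * xcomp_shift A B (Cof X) m"
    proof (cases "m = n")
      case True
      have nn: "(n = 0) = False" "(n \<le> n - 1) = False" using n1 by auto
      show ?thesis unfolding True nn by (simp only: if_True if_False refl 1 2 h)
    next
      case False
      then have "(if m = 0 then q * Cof X * xcomp_par X n else if m \<le> n - 1 then xcomp_shift A B (Cof X) m else xcomp_par X (m - 1)) = xcomp_shift A B (Cof X) m"
        using m h0 by auto
      then show ?thesis using False by (simp only: if_False 2)
    qed
  qed
  let ?D = "\<Prod>l\<in>{1..n}. (1 - A (int l)) / (1 - q * B (int l))"
  have D: "lin_prod A n 1 / lin_prod (Bof n q W) n 1 = ?D"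
    unfolding lin_prod_def prod_dividef[symmetric] using B by (intro prod.cong) auto
  have gW: "generic n q (\<lambda>j. q * A (j - 1)) (Bof n q W) (Cof X)"
    using okW unfolding admissible_def A C .
  have "lin_prod A n 1 \<noteq> 0" "lin_prod (Bof n q W) n 1 \<noteq> 0"
    using lin_prod_A_nonzero[OF g, of n 0] lin_prod_B_nonzero'[OF gW] by (auto simp: A_def)
  then have D0: "?D \<noteq> 0" unfolding D[symmetric] by simp
  show "xvec n q W = inverse (q * ?D) \<cdot>\<^sub>v (wmat n q lc lq lg u X *\<^sub>v xvec n q X)"
    unfolding M smult_rev_vec xvec_eq[OF okW]
  proof (rule rev_vec_cong)
    fix m assume "m \<le> n"
    then have "xcomp_shift A B (Cof X) m = q * Cof X * lin_prod A n 1 / lin_prod (Bof n q W) n 1 * xcomp_par W m"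
      using xcomp_shift_eq_xcomp[OF g gW[unfolded A_def], of m] B unfolding xcomp_par_def A C by (simp add: A_def B_def)
    then have h: "xcomp_shift A B (Cof X) m = Cof X * ((q * ?D) * xcomp_par W m)"
      unfolding D[symmetric] by simp
    have inv: "x = inverse e * (inverse c * (c * (e * x)))" if "e \<noteq> 0" "c \<noteq> 0" for x e c :: complex
      using that by (simp add: mult.assoc[symmetric])
    show "xcomp_par W m = inverse (q * ?D) * (inverse (Cof X) * xcomp_shift A B (Cof X) m)"
      unfolding h by (rule inv) (use D0 q0 admissibleD(5)[OF admissible] in simp_all)
  qed
qed

lemma admissible_if_generic:
  assumes ga: "\<And>m k l. k \<in> {1..int n + 1} \<Longrightarrow> l \<in> {1..int n} \<Longrightarrow> a k \<noteq> q powi m * b l"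
    and gaq: "\<And>m k. k \<in> {1..int n + 1} \<Longrightarrow> a k \<noteq> q powi m"
    and gb0: "\<And>l. l \<in> {1..int n} \<Longrightarrow> b l \<noteq> 0"
    and gbb: "\<And>m k l. k \<in> {1..int n} \<Longrightarrow> l \<in> {1..int n} \<Longrightarrow> k \<noteq> l \<Longrightarrow> b k \<noteq> q powi m * b l"
    and gbq: "\<And>m l. l \<in> {1..int n} \<Longrightarrow> b l \<noteq> q powi m"
    and c: "c \<noteq> 0" "norm c < inverse (norm q)"
  shows "admissible (a, b, c)"
proof -
  let ?A = "Aof n q (a, b, c)" and ?B = "Bof n q (a, b, c)" and ?N = "int (n + 1)"
  let ?b = "b(int n + 1 := q)"
  define d r where "d j = (j - 1) div ?N" and "r j = (j - 1) mod ?N + 1" for j :: int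
  have r: "r j \<in> {1..int n + 1}" for j
  proof -
    have "0 \<le> (j - 1) mod ?N" "(j - 1) mod ?N < ?N" by (rule pos_mod_sign pos_mod_bound, simp)+
    then show ?thesis unfolding r_def atLeastAtMost_iff by linarith
  qed
  have A: "?A j = q powi d j * a (r j)" and B: "?B j = q powi d j * ?b (r j)" for j
    by (simp_all only: Aof_def Bof_def qext_def d_def r_def fst_conv snd_conv)
  have q': "q powi s \<noteq> 0" for s using q0 by simp
  have move: "q powi s * x = q powi t * y \<longleftrightarrow> x = q powi (t - s) * y" for s t x y
    using q' by (simp add: power_int_diff[OF disjI1[OF q0]] field_simps)
  have AB: "?A k \<noteq> ?B l" for k l
  proof -
    have "a (r k) \<noteq> q powi m * ?b (r l)" for m
    proof (cases "r l = int n + 1")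
      case True
      have "a (r k) \<noteq> q powi (m + 1)" using gaq r by blast
      then show ?thesis using True q0 by (simp add: power_int_add)
    next
      case False
      then have "r l \<in> {1..int n}" using r[of l] by auto
      then show ?thesis using ga[OF r] False by simp
    qed
    then show ?thesis unfolding A B move by blast
  qed
  have b0: "?b (r l) \<noteq> 0" for l
    using gb0[of "r l"] r[of l] q0 by (cases "r l = int n + 1") auto
  have "inj ?B"
  proof (rule injI)
    fix k l assume "?B k = ?B l"
    then have e: "?b (r k) = q powi (d l - d k) * ?b (r l)" unfolding B move .
    have "r k = r l"
    proof (rule ccontr)
      assume ne: "r k \<noteq> r l"
      consider "r k = int n + 1" "r l \<in> {1..int n}" | "r l = int n + 1" "r k \<in> {1..int n}"
        | "r k \<in> {1..int n}" "r l \<in> {1..int n}"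
        using ne r[of k] r[of l] by fastforce
      then show False
      proof cases
        case 1
        then have "q powi 1 * 1 = q powi (d l - d k) * b (r l)" using e by simp
        then have "q powi (d l - d k) * b (r l) = q powi 1 * 1" by simp
        then show False unfolding move using gbq 1 by simp
      next
        case 2
        then have "b (r k) = q powi (d l - d k + 1)" using e q0 by (simp add: power_int_add)
        then show False using gbq 2 by blast
      next
        case 3
        then show False using gbb[OF 3 ne] e by simp
      qed
    qed
    moreover have "d k = d l"
    proof -
      have "q powi (d l - d k) = 1" using e b0[of l] unfolding \<open>r k = r l\<close> by simp
      then have n1: "norm q powi (d l - d k) = 1" using norm_power_int[of q "d l - d k"] by simp
      have qpoch_prod: "0 < norm q" using q0 by simp
      show ?thesis
        using power_int_strict_decreasing[OF _ qpoch_prod q1, of 0 "d l - d k"]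
          power_int_strict_decreasing[OF _ qpoch_prod q1, of "d l - d k" 0] n1
        by (cases "d l - d k" "0 :: int" rule: linorder_cases) auto
    qed
    ultimately have "(k - 1) div ?N * ?N + (k - 1) mod ?N = (l - 1) div ?N * ?N + (l - 1) mod ?N"
      unfolding d_def r_def by simp
    then show "k = l" unfolding div_mult_mod_eq by simp
  qed
  moreover have "norm (q * c) < 1"
    using c(2) q0 by (simp add: norm_mult field_simps)
  moreover have "?B 0 = 1"
  proof -
    have "?B (int n + 1) = q" unfolding Bof_def by (subst qext_in) auto
    then have "q * ?B 0 = q" using quasi_periodic_Bof[of "(a, b, c)"] unfolding quasi_periodic_def by (metis add_0 of_nat_1 of_nat_add)
    then show ?thesis using q0 by simp
  qed
  ultimately show ?thesis
    unfolding admissible_def generic_def using AB c(1) quasi_periodic_Aof quasi_periodic_Bof by (simp add: Cof_def)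
qed

lemma fst_Aof: "1 \<le> k \<Longrightarrow> k \<le> n + 1 \<Longrightarrow> fst X (int k) = Aof n q X (int k)"
  unfolding Aof_def by (rule qext_in[symmetric]) auto

lemma snd_Bof: "1 \<le> k \<Longrightarrow> k \<le> n \<Longrightarrow> fst (snd X) (int k) = Bof n q X (int k)"
  unfolding Bof_def by (subst qext_in) auto

lemma pword_state:
  assumes admissible: "admissible X" and i: "1 \<le> i" "i \<le> n + 1"
  defines "Y \<equiv> act n q (pword n i) X"
  shows "admissible Y" "Bof n q Y = Bof n q X" "Cof Y = Cof X"
    "\<And>k. 1 \<le> k \<Longrightarrow> k \<le> n + 1 \<Longrightarrow> Aof n q Y (int k - 1) = q powi (- (if i = k then 1 else 0)) * Aof n q X (int k)"
    "xvec n q Y = 1 \<cdot>\<^sub>v (wmat n q lc lq lg (pword n i) X *\<^sub>v xvec n q X)"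
proof -
  have ex: "exact w" if "w \<in> set (pword n i)" for w
    using that by (auto simp: pword_def)
  show "admissible Y" unfolding Y_def by (rule admissible_exact_word[OF ex admissible])
  show "Bof n q Y = Bof n q X" "Cof Y = Cof X" unfolding Y_def pword_def by (simp_all add: act_pword)
  show "xvec n q Y = 1 \<cdot>\<^sub>v (wmat n q lc lq lg (pword n i) X *\<^sub>v xvec n q X)"
    unfolding Y_def by (rule xvec_exact_word[OF ex admissible])
  fix k :: nat assume k: "1 \<le> k" "k \<le> n + 1"
  show "Aof n q Y (int k - 1) = q powi (- (if i = k then 1 else 0)) * Aof n q X (int k)"
    using cyc_shift_a[OF i k] quasi_periodic_minus[OF quasi_periodic_Aof q0, of X "int k"]
    unfolding Y_def pword_def act_pword[OF order_refl] by (simp add: power_int_minus)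
qed

lemma tau_action:
  assumes admissible: "admissible X" and i: "1 \<le> i" "i \<le> n + 1"
  defines "W \<equiv> act n q (tau_word n i) X"
  shows "1 \<le> k \<Longrightarrow> k \<le> n + 1 \<Longrightarrow> fst W (int k) = q powi (- (if i = k then 1 else 0)) * Aof n q X (int k)"
    "1 \<le> k \<Longrightarrow> k \<le> n \<Longrightarrow> fst (snd W) (int k) = Bof n q X (int k)"
    "snd (snd W) = Cof X"
    "xvec n q W = wmat n q lc lq lg (tau_word n i) X *\<^sub>v xvec n q X"
proof -
  let ?Y = "act n q (pword n i) X"
  note Y = pword_state[OF admissible i]
  have W: "W = subst n q Sig ?Y" by (simp add: W_def tau_word_def act_append del: subst.simps)
  show "fst W (int k) = q powi (- (if i = k then 1 else 0)) * Aof n q X (int k)" if "1 \<le> k" "k \<le> n + 1"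
    unfolding fst_Aof[OF that] unfolding W state_Sig using Y(4)[OF that] .
  show "fst (snd W) (int k) = Bof n q X (int k)" if "1 \<le> k" "k \<le> n"
    unfolding snd_Bof[OF that] unfolding W state_Sig Y(2) ..
  show "snd (snd W) = Cof X"
    using state_Sig(3)[of ?Y] unfolding W Y(3) by (simp add: Cof_def)
  have "xvec n q W = 1 \<cdot>\<^sub>v (wmat n q lc lq lg (tau_word n i) X *\<^sub>v xvec n q X)"
    unfolding W_def by (rule xvec_exact_word[OF _ admissible]) (auto simp: tau_word_def pword_def)
  then show "xvec n q W = wmat n q lc lq lg (tau_word n i) X *\<^sub>v xvec n q X"
    by simp
qed

lemma tau2_action_le:
  assumes admissible: "admissible X" and i: "1 \<le> i" "i \<le> n + 1" and j: "1 \<le> j" "j \<le> n"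
    and cp: "cpw lc lq lg (inverse q * Bof n q X (int j)) * cpw lc lq lg (q / Bof n q X (int j)) = 1"
  defines "W \<equiv> act n q (tau2_word n i j) X"
  shows "1 \<le> k \<Longrightarrow> k \<le> n + 1 \<Longrightarrow> fst W (int k) = q powi (- (if i = k then 1 else 0)) * Aof n q X (int k)"
    "1 \<le> k \<Longrightarrow> k \<le> n \<Longrightarrow> fst (snd W) (int k) = q powi (- (if j = k then 1 else 0)) * Bof n q X (int k)"
    "snd (snd W) = Cof X"
    "xvec n q W = inverse (Delta n q X i j) \<cdot>\<^sub>v (wmat n q lc lq lg (tau2_word n i j) X *\<^sub>v xvec n q X)"
proof -
  define Y where "Y = act n q (pword n i) X"
  define Z where "Z = act n q (map P' [j..<n]) Y"
  define V where "V = act n q [P' n, Pi1] Z"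
  note Y = pword_state[OF admissible i, folded Y_def]
  have ex1: "exact w" if "w \<in> set (map P' [j..<n])" for w using that j by auto
  have ex2: "exact w" if "w \<in> set (map P' [1..<j])" for w using that j by auto
  have wd: "tau2_word n i j = ((pword n i @ map P' [j..<n]) @ [P' n, Pi1]) @ map P' [1..<j]"
    using j by (simp add: tau2_word_def)
  have "[j..<n] = [j..<j + (n - j)]" "[1..<j] = [1..<1 + (j - 1)]" using j by simp_all
  note Z = act_P'word[OF j(1) _ Y(1), of "n - j", folded this(1), folded Z_def]
  have W: "W = act n q (map P' [1..<j]) V"
    by (simp add: W_def wd act_append V_def Z_def Y_def del: subst.simps)
  have jn: "j + (n - j) \<le> n" "1 + (j - 1) \<le> n" using j by auto
  note Z = Z[OF jn(1)]
  have bn: "Bof n q Z (int n) = Bof n q X (int j)"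
    unfolding Z(2) Y(2) cyc_last[OF j(2)] ..
  note V = block_swap[OF Z(4), folded V_def, unfolded bn]
  note W' = act_P'word[OF order_refl jn(2) V(4), folded \<open>[1..<j] = _\<close>, folded W]
  have Aw: "Aof n q W = (\<lambda>k. Aof n q Y (k - 1))" unfolding W'(1) V(1) Z(1) ..
  show "fst W (int k) = q powi (- (if i = k then 1 else 0)) * Aof n q X (int k)" if "1 \<le> k" "k \<le> n + 1"
    unfolding fst_Aof[OF that] Aw using Y(4)[OF that] .
  show "fst (snd W) (int k) = q powi (- (if j = k then 1 else 0)) * Bof n q X (int k)" if "1 \<le> k" "k \<le> n"
    using cyc_shift_b[OF j that] quasi_periodic_minus[OF quasi_periodic_Bof q0, of X "int k"]
    unfolding snd_Bof[OF that] W'(2) V(2) Z(2) Y(2) by (simp add: power_int_minus)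
  show "snd (snd W) = Cof X" using W'(3) V(3) Z(3) Y(3) by (simp add: Cof_def)
  have A0: "Aof n q Z 0 = q powi (- (if i = 1 then 1 else 0)) * Aof n q X 1"
    using Y(4)[of 1] unfolding Z(1) by simp
  have e1: "xvec n q Z = 1 \<cdot>\<^sub>v (wmat n q lc lq lg (map P' [j..<n]) Y *\<^sub>v xvec n q Y)"
    unfolding Z_def by (rule xvec_exact_word[OF ex1 Y(1)])
  have e2: "xvec n q W = 1 \<cdot>\<^sub>v (wmat n q lc lq lg (map P' [1..<j]) V *\<^sub>v xvec n q V)"
    unfolding W by (rule xvec_exact_word[OF ex2 V(4)])
  have x1: "xvec n q Z = (1 * 1) \<cdot>\<^sub>v (wmat n q lc lq lg (pword n i @ map P' [j..<n]) X *\<^sub>v xvec n q X)"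
    using xvec_append[of "pword n i" X _ lc lq lg "map P' [j..<n]"] Y(5) e1
    by (simp only: Z_def Y_def act_append)
  have x2: "xvec n q V = (1 * 1 * ((1 - Aof n q Z 0) / (1 - Bof n q X (int j)))) \<cdot>\<^sub>v
     (wmat n q lc lq lg ((pword n i @ map P' [j..<n]) @ [P' n, Pi1]) X *\<^sub>v xvec n q X)"
    using xvec_append[of "pword n i @ map P' [j..<n]" X _ lc lq lg "[P' n, Pi1]"] x1 V(5)[OF cp]
    by (simp only: Z_def Y_def V_def act_append)
  have "xvec n q W = (1 * 1 * ((1 - Aof n q Z 0) / (1 - Bof n q X (int j))) * 1) \<cdot>\<^sub>v
     (wmat n q lc lq lg (tau2_word n i j) X *\<^sub>v xvec n q X)"
    unfolding wd using xvec_append[of "(pword n i @ map P' [j..<n]) @ [P' n, Pi1]" X _ lc lq lg "map P' [1..<j]"] x2 e2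
    by (simp only: Z_def Y_def V_def W act_append)
  moreover have "(1 - Aof n q Z 0) / (1 - Bof n q X (int j)) = inverse (Delta n q X i j)"
    unfolding A0 Delta_def Let_def using j by (simp add: power_int_minus)
  ultimately show "xvec n q W = inverse (Delta n q X i j) \<cdot>\<^sub>v (wmat n q lc lq lg (tau2_word n i j) X *\<^sub>v xvec n q X)"
    by simp
qed

lemma tau2_action_last:
  assumes admissible: "admissible X" and i: "1 \<le> i" "i \<le> n + 1"
    and cp: "cpw lc lq lg (inverse q * Bof n q X (int n)) * cpw lc lq lg (1 / Bof n q X (int n)) = inverse (Cof X)"
  defines "W \<equiv> act n q (tau2_word n i (n + 1)) X"
  shows "1 \<le> k \<Longrightarrow> k \<le> n + 1 \<Longrightarrow> fst W (int k) = q powi (1 - (if i = k then 1 else 0)) * Aof n q X (int k)"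
    "1 \<le> k \<Longrightarrow> k \<le> n \<Longrightarrow> fst (snd W) (int k) = q * Bof n q X (int k)"
    "snd (snd W) = Cof X"
    "xvec n q W = inverse (Delta n q X i (n + 1)) \<cdot>\<^sub>v (wmat n q lc lq lg (tau2_word n i (n + 1)) X *\<^sub>v xvec n q X)"
proof -
  define Y where "Y = act n q (pword n i) X"
  note Y = pword_state[OF admissible i, folded Y_def]
  have wd: "tau2_word n i (n + 1) = pword n i @ (Pi1 # map P' [1..<n + 1])"
    by (simp add: tau2_word_def)
  have W: "W = act n q (Pi1 # map P' [1..<n + 1]) Y"
    unfolding W_def wd act_append Y_def ..
  note W' = block_shift[OF Y(1), folded W, unfolded Y(2,3)]
  show "fst W (int k) = q powi (1 - (if i = k then 1 else 0)) * Aof n q X (int k)" if "1 \<le> k" "k \<le> n + 1"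
    unfolding fst_Aof[OF that] W'(1) using Y(4)[OF that] q0 by (simp add: power_int_minus)
  show "fst (snd W) (int k) = q * Bof n q X (int k)" if "1 \<le> k" "k \<le> n"
    unfolding snd_Bof[OF that] using W'(2)[of "int k"] that by simp
  show "snd (snd W) = Cof X" using W'(3) by (simp add: Cof_def)
  let ?f = "\<lambda>l. (1 - Aof n q X (int l + 1)) / (1 - q * Bof n q X (int l))"
  let ?e = "if i \<noteq> 1 then (1 - inverse q * Aof n q X (int i)) / (1 - Aof n q X (int i)) else 1"
  have "(\<Prod>l\<in>{1..n}. (1 - Aof n q Y (int l)) / (1 - q * Bof n q X (int l))) = (\<Prod>l\<in>{1..n}. ?f l * (if l = i - 1 then ?e else 1))"
  proof (rule prod.cong[OF refl])
    fix l assume l: "l \<in> {1..n}"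
    have "1 - Aof n q X (int i) \<noteq> 0" using generic_nonzero(1)[OF admissible[unfolded admissible_def], of 0 "int i"] by simp
    moreover have "Aof n q Y (int l) = q powi (- (if i = l + 1 then 1 else 0)) * Aof n q X (int l + 1)"
      using Y(4)[of "l + 1"] l by (simp add: add.commute)
    ultimately show "(1 - Aof n q Y (int l)) / (1 - q * Bof n q X (int l)) = ?f l * (if l = i - 1 then ?e else 1)"
      using l i by (auto simp: power_int_minus add.commute)
  qed
  also have "\<dots> = (\<Prod>l\<in>{1..n}. ?f l) * ?e"
  proof -
    have "(\<Prod>l\<in>{1..n}. if l = i - 1 then ?e else 1) = ?e"
      using i by (cases "i = 1") (simp, subst prod.delta, auto)
    then show ?thesis unfolding prod.distrib by simp
  qed
  finally have D: "q * (\<Prod>l\<in>{1..n}. (1 - Aof n q Y (int l)) / (1 - q * Bof n q X (int l))) = Delta n q X i (n + 1)"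
    by (simp add: Delta_def Let_def mult_ac)
  have "xvec n q W = (1 * inverse (Delta n q X i (n + 1))) \<cdot>\<^sub>v (wmat n q lc lq lg (tau2_word n i (n + 1)) X *\<^sub>v xvec n q X)"
    unfolding wd using xvec_append[OF Y(5)[unfolded Y_def], of "Pi1 # map P' [1..<n + 1]"] W'(5)[OF cp, unfolded D]
    by (simp only: Y_def W act_append)
  then show "xvec n q W = inverse (Delta n q X i (n + 1)) \<cdot>\<^sub>v (wmat n q lc lq lg (tau2_word n i (n + 1)) X *\<^sub>v xvec n q X)"
    by simp
qed

end

theorem theorem5p1:
  fixes n :: nat and q c lc lq :: complex and a b :: "int \<Rightarrow> complex"
    and lg :: "complex \<Rightarrow> complex"
  assumes n: "n \<ge> 1"
    and q: "0 < norm q" "norm q < 1"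
    and conv: "norm c < inverse (norm q)" and c0: "c \<noteq> 0"
    \<comment> \<open>fixed branches of the logarithms\<close>
    and lc: "exp lc = c" and lq: "exp lq = q"
    and lg: "\<And>u. u \<noteq> 0 \<Longrightarrow> exp (lg u) = u"
    \<comment> \<open>compatibility of the fixed branches (see NOTES.md, FIDELITY)\<close>
    and br1: "\<And>j. j \<in> {1..int n} \<Longrightarrow> lg (q / b j) + lg (b j / q) = 0"
    and br2: "lg (b (int n) / q) + lg (1 / b (int n)) = - lq"
    \<comment> \<open>genericity of the parameters\<close>
    and ga0: "\<And>k. k \<in> {1..int n + 1} \<Longrightarrow> a k \<noteq> 0"
    and gb0: "\<And>l. l \<in> {1..int n} \<Longrightarrow> b l \<noteq> 0"
    and gab: "\<And>m k l. k \<in> {1..int n + 1} \<Longrightarrow> l \<in> {1..int n} \<Longrightarrow> a k \<noteq> q powi m * b l"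
    and gaq: "\<And>m k. k \<in> {1..int n + 1} \<Longrightarrow> a k \<noteq> q powi m"
    and gaa: "\<And>m k l. k \<in> {1..int n + 1} \<Longrightarrow> l \<in> {1..int n + 1} \<Longrightarrow> k \<noteq> l \<Longrightarrow> a k \<noteq> q powi m * a l"
    and gbb: "\<And>m k l. k \<in> {1..int n} \<Longrightarrow> l \<in> {1..int n} \<Longrightarrow> k \<noteq> l \<Longrightarrow> b k \<noteq> q powi m * b l"
    and gbq: "\<And>m l. l \<in> {1..int n} \<Longrightarrow> b l \<noteq> q powi m"
  shows
    "(\<forall>i\<in>{1..n+1}.
        (\<forall>k\<in>{1..n+1}. fst (act n q (tau_word n i) (a, b, c)) (int k)
                        = q powi (- (if i = k then 1 else 0)) * a (int k))
      \<and> (\<forall>k\<in>{1..n}. fst (snd (act n q (tau_word n i) (a, b, c))) (int k) = b (int k))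
      \<and> snd (snd (act n q (tau_word n i) (a, b, c))) = c
      \<and> xvec n q (act n q (tau_word n i) (a, b, c))
          = wmat n q lc lq lg (tau_word n i) (a, b, c) *\<^sub>v xvec n q (a, b, c))
   \<and> (\<forall>i\<in>{1..n+1}. \<forall>j\<in>{1..n+1}.
        (\<forall>k\<in>{1..n+1}. fst (act n q (tau2_word n i j) (a, b, c)) (int k)
           = q powi ((if j = n + 1 then 1 else 0) - (if i = k then 1 else 0)) * a (int k))
      \<and> (\<forall>k\<in>{1..n}. fst (snd (act n q (tau2_word n i j) (a, b, c))) (int k)
           = q powi ((if j = n + 1 then 1 else 0) - (if j = k then 1 else 0)) * b (int k))
      \<and> snd (snd (act n q (tau2_word n i j) (a, b, c))) = c
      \<and> xvec n q (act n q (tau2_word n i j) (a, b, c))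
          = (inverse (Delta n q (a, b, c) i j) \<cdot>\<^sub>m wmat n q lc lq lg (tau2_word n i j) (a, b, c))
              *\<^sub>v xvec n q (a, b, c))"
proof -
  interpret qhyp n q using n q by unfold_locales auto
  let ?X = "(a, b, c)"
  have admissible: "admissible ?X"
    by (rule admissible_if_generic[OF gab gaq gb0 gbb gbq c0 conv])
  have A: "Aof n q ?X (int k) = a (int k)" if "k \<in> {1..n + 1}" for k
    using fst_Aof[of k ?X] that by simp
  have B: "Bof n q ?X (int k) = b (int k)" if "k \<in> {1..n}" for k
    using snd_Bof[of k ?X] that by simp
  have C: "Cof ?X = c" by (simp add: Cof_def)
  have lq0: "lq \<noteq> 0" using lq q by auto
  have cp1: "cpw lc lq lg (inverse q * Bof n q ?X (int j)) * cpw lc lq lg (q / Bof n q ?X (int j)) = 1"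
    if j: "1 \<le> j" "j \<le> n" for j
  proof -
    have "inverse q * b (int j) = b (int j) / q" by (simp add: field_simps)
    moreover have "lc * lg (b (int j) / q) / lq + lc * lg (q / b (int j)) / lq =
        lc * (lg (q / b (int j)) + lg (b (int j) / q)) / lq"
      by (simp add: distrib_left add_divide_distrib)
    ultimately show ?thesis
      using br1[of "int j"] j B[of j] by (simp add: cpw_def flip: exp_add)
  qed
  have cp2: "cpw lc lq lg (inverse q * Bof n q ?X (int n)) * cpw lc lq lg (1 / Bof n q ?X (int n)) = inverse (Cof ?X)"
  proof -
    have "inverse q * b (int n) = b (int n) / q" by (simp add: field_simps)
    moreover have "lc * lg (b (int n) / q) / lq + lc * lg (1 / b (int n)) / lq =
        lc * (lg (b (int n) / q) + lg (1 / b (int n))) / lq"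
      by (simp add: distrib_left add_divide_distrib)
    ultimately show ?thesis
      unfolding C using br2 n B[of n] lq0 lc by (simp add: cpw_def exp_minus flip: exp_add)
  qed
  have sm: "(s \<cdot>\<^sub>m wmat n q lc lq lg w ?X) *\<^sub>v xvec n q ?X = s \<cdot>\<^sub>v (wmat n q lc lq lg w ?X *\<^sub>v xvec n q ?X)" for s w
  proof -
    obtain f where f: "wmat n q lc lq lg w ?X *\<^sub>v xvec n q ?X = rev_vec n f"
    proof
      show "wmat n q lc lq lg w ?X *\<^sub>v xvec n q ?X = rev_vec n (\<lambda>m. (wmat n q lc lq lg w ?X *\<^sub>v xvec n q ?X) $ (n - m))"
        using wmat_carrier[of n q lc lq lg w ?X] by (intro eq_vecI) (auto simp: rev_vec_def)
    qed
    show ?thesis unfolding f smult_rev_vec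
      using smult_mat_rev_vec[OF wmat_carrier f[unfolded xvec_eq[OF admissible]]] unfolding xvec_eq[OF admissible] .
  qed
  show ?thesis
  proof (intro conjI ballI)
    fix i assume "i \<in> {1..n + 1}"
    then have i: "1 \<le> i" "i \<le> n + 1" by auto
    note T = tau_action[OF admissible i]
    show "fst (act n q (tau_word n i) ?X) (int k) = q powi (- (if i = k then 1 else 0)) * a (int k)" if "k \<in> {1..n+1}" for k
      using T(1)[of k] that A[OF that] by simp
    show "fst (snd (act n q (tau_word n i) ?X)) (int k) = b (int k)" if "k \<in> {1..n}" for k
      using T(2)[of k] that B[OF that] by simp
    show "snd (snd (act n q (tau_word n i) ?X)) = c" using T(3) C by simp
    show "xvec n q (act n q (tau_word n i) ?X) = wmat n q lc lq lg (tau_word n i) ?X *\<^sub>v xvec n q ?X" by (rule T(4))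
    fix j assume "j \<in> {1..n + 1}"
    then consider "1 \<le> j" "j \<le> n" | "j = n + 1" by fastforce
    note j = this
    show "fst (act n q (tau2_word n i j) ?X) (int k)
           = q powi ((if j = n + 1 then 1 else 0) - (if i = k then 1 else 0)) * a (int k)" if "k \<in> {1..n+1}" for k
      using j
    proof cases
      case 1
      then show ?thesis using tau2_action_le(1)[OF admissible i 1 cp1[OF 1], of k] A[OF that] that by simp
    next
      case 2
      then show ?thesis using tau2_action_last(1)[OF admissible i cp2, of k] A[OF that] that by simp
    qed
    show "fst (snd (act n q (tau2_word n i j) ?X)) (int k)
           = q powi ((if j = n + 1 then 1 else 0) - (if j = k then 1 else 0)) * b (int k)" if "k \<in> {1..n}" for k
      using j
    proof cases
      case 1
      then show ?thesis using tau2_action_le(2)[OF admissible i 1 cp1[OF 1], of k] B[OF that] that by simp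
    next
      case 2
      then show ?thesis using tau2_action_last(2)[OF admissible i cp2, of k] B[OF that] that by simp
    qed
    show "snd (snd (act n q (tau2_word n i j) ?X)) = c"
      using j
    proof cases
      case 1
      then show ?thesis using tau2_action_le(3)[OF admissible i 1 cp1[OF 1]] C by simp
    next
      case 2
      then show ?thesis using tau2_action_last(3)[OF admissible i cp2] C by simp
    qed
    show "xvec n q (act n q (tau2_word n i j) ?X)
          = (inverse (Delta n q ?X i j) \<cdot>\<^sub>m wmat n q lc lq lg (tau2_word n i j) ?X) *\<^sub>v xvec n q ?X"
      using j
    proof cases
      case 1
      then show ?thesis using tau2_action_le(4)[OF admissible i 1 cp1[OF 1]] by (simp only: sm)
    next
      case 2
      then show ?thesis using tau2_action_last(4)[OF admissible i cp2] by (simp only: sm)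
    qed
  qed
qed

end
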